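(* Let $L$ be a skew basic $(p,q)$-leaper, $p<q$, $D$ a canonical second leaper cycle of a skew basic canonical second leaper over the squares of a cycle $C$ of $L$ within a $(p+q)\times(p+q)$ chessboard, $e$ the descent of $D$, and $o$ the origin of $D$. Then $D$ is trivial and the direction graph extracted from $D$ depends only on $e$ and $o$. Equivalently, let $C$ be a cycle of type $k$. Then the direction graph extracted from $D$ depends only on the $k$-th convergent $[c_1\pm,c_2\pm,\ldots,c_k]$ of the even continued fraction representation of $\frac qp$ and the sign following $c_k$ in that representation.
   Context: Leapers. A square is a unit square of the infinite chessboard. A $(p,q)$-leaper is a piece that moves from a square $a$ to any of $a+(\pm p,\pm q)$, $a+(\pm q,\pm p)$. The leaper graph of $L$ over a set of squares $B$ has the squares of $B$ as vertices, two being adjacent when a move of $L$ joins them; a cycle of $L$ within $B$ is a simple cycle in this graph. The leaper is basic if $p+q$ is odd and $\gcd(p,q)=1$, and skew if $p,q$ are nonzero and distinct. Frames. Let $m<n$ be coprime positive integers with $m+n$ odd. Identify squares with their centers, the centers being the points of $\mathbb Z^2$. The $(m,n)$-frame $F$ is the set of squares $(x,y)$ with $\frac{n-m}2<\max(|x|,|y|)<\frac{m+n}2$, i.e. an $(m+n)\times(m+n)$ board with an $(n-m)\times(n-m)$ central hole. Its section $F_{\mathtt E}$ consists of the squares with $\frac{n-m}2<x<\frac{m+n}2$, $|y|<\frac{n-m}2$; its section $F_{\mathtt{NE}}$ of those with $\frac{n-m}2<x,y<\frac{m+n}2$; the sections $F_{\mathtt N},F_{\mathtt{NW}},F_{\mathtt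 W},F_{\mathtt{SW}},F_{\mathtt S},F_{\mathtt{SE}}$ are obtained by counterclockwise rotations by multiples of $90^\circ$ about the origin. In the leaper graph of the $(m,n)$-leaper over the $(m+n)\times(m+n)$ board the squares of the hole are isolated and all squares of $F$ have degree two, so a cycle is determined by its vertex set. Lifting. The lifting transformations $\mathtt f,\mathtt g,\mathtt h$ take $S\subseteq F$ to the disjoint union of $(S+v_i)\cap H_i$ over the eight directions $i$, where $H$ is respectively the $(m,2m+n)$-, $(n,2n-m)$-, $(n,m+2n)$-frame, and for $\mathtt f$: $v_{\mathtt E}=(m+n,0)$, $v_{\mathtt{NE}}=(m,m)$; for $\mathtt g$: $v_{\mathtt E}=(n-m,0)$, $v_{\mathtt{NE}}=(n,n)$; for $\mathtt h$: $v_{\mathtt E}=(m+n,0)$, $v_{\mathtt{NE}}=(n,n)$; the other $v_i$ are obtained by $90^\circ$ rotations. Each maps the vertex set of a cycle of the $(m,n)$-leaper within $F$ to the vertex set of a cycle of the leaper with the proportions of $H$ within $H$; this defines the lift of a cycle. Shell. Let $n\le3m$. If $2m\ge n$, the shell of $F$ is the union of eight $(n-m)\times(n-m)$ subboards: the four corners of $F$ and the four adjacent by side to the central hole. If $2m\le n\le3m$, it is the union of eight $(3m-n)\times(3m-n)$ subboards: one in the middle of each outer side and four adjacent by corner to the central hole. (When $n=2m$ both give all of $F$.) The shell is a union of eight-square cycles of the $(m,n)$-leaper, called shell cycles; each visits exactly one square in each section. Descents. The descent of a skew basic $(p,q)$-leaper, $p<q$, is the unique string $e_1\ldots e_l$ of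 characters $\mathtt f,\mathtt g,\mathtt h$ such that successively applying lifting transformations of types $e_l,\ldots,e_1$ to a $(1,2)$-frame gives a $(p,q)$-frame. The descent of a cycle $C$ of $L$ within a $(p+q)\times(p+q)$ board is the prefix $e_1\ldots e_j$ of the descent of $L$ such that $C$ is obtained from a shell cycle $C'$ of the frame $F'$ whose leaper has descent $e_{j+1}\ldots e_l$ by successively applying lifting transformations of types $e_j,\ldots,e_1$. Either $j=l$ and $F'$ is a $(1,2)$-frame, or $j<l$ and $e_{j+1}\in\{\mathtt g,\mathtt h\}$. Canonical second leaper cycles. Let $L$ be a skew basic $(p,q)$-leaper, $p<q$, of descent $e_1\ldots e_l$, let $C$ be a cycle of $L$ of descent $e_1\ldots e_j$ within a $(p+q)\times(p+q)$ board, let $F'$ be the frame whose leaper has descent $e_{j+1}\ldots e_l$, and let $C'$ be the shell cycle of $F'$ from which $C$ is obtained by successively applying lifting transformations of types $e_j,\ldots,e_1$. The canonical second leaper $M$ associated with $C$ is the $(0,1)$-leaper if $j=l$, and the skew basic leaper of descent $e_{j+2}\ldots e_l$ if $j<l$. The canonical second leaper cycle over the squares of $C'$ is the cycle of $M$ visiting the eight squares of $C'$ in the order of their sections $\mathtt E,\mathtt{NE},\mathtt N,\mathtt{NW},\mathtt W,\mathtt{SW},\mathtt S,\mathtt{SE}$, written as a concatenation $a_0a_1\ldots a_7$ of eight one-square paths. Number the directions $\mathtt E,\mathtt{NE},\ldots,\mathtt{SE}$ by $0,\ldots,7$ modulo $8$, let $u_0=(1,0)$, $u_1=(1,1)$,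 $u_2=(0,1)$, $u_3=(-1,1)$, $u_{i+4}=-u_i$, and let $-w$ be the path $w$ traversed backwards. A cycle $a_0a_1\ldots a_7$ of $M$ within an $(m,n)$-frame, split into eight paths with $a_i$ in the section of direction $i$, is lifted to $b_0b_1\ldots b_7$ within the larger frame by the rules: $\mathtt f$: $b_i=(-a_{i+5})(-a_{i+4})(-a_{i+3})+(m+n)u_i$ for $i$ even, $b_i=a_i+mu_i$ for $i$ odd; $\mathtt g$: $b_i=a_i+(n-m)u_i$ for $i$ even, $b_i=(-a_{i+5})(-a_{i+4})(-a_{i+3})+nu_i$ for $i$ odd; $\mathtt h$: $b_i=(-a_{i+6})(-a_{i+5})(-a_{i+4})(-a_{i+3})(-a_{i+2})+(m+n)u_i$ for $i$ even, $b_i=a_{i-1}a_ia_{i+1}+nu_i$ for $i$ odd. The canonical second leaper cycle $D$ over the squares of $C$ is obtained from the one over the squares of $C'$ by successively applying the lifts of types $e_j,\ldots,e_1$; it is a Hamiltonian cycle of $M$ over the squares of $C$. When $M$ is skew (so $j<l$), the descent of $D$ is $e_1\ldots e_j$ and the origin of $D$ is $e_{j+1}\in\{\mathtt g,\mathtt h\}$. Even continued fractions and types. $[c_1\pm,\ldots,c_K]=c_1\pm\cfrac1{c_2\pm\cfrac1{\ddots\pm\frac1{c_K}}}$, with independent signs, all $c_i$ even integers, $c_1\ge0$, $c_2,\ldots,c_K>0$; every $\frac qp$ with $p,q$ coprime and $p+q$ odd has a unique such representation, and its $k$-th convergent is $[c_1\pm,\ldots,c_k]$ with the same signs. The descent of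 $L$ is $\mathtt f^{c_1/2-1}x_1\mathtt f^{c_2/2-1}x_2\cdots x_{K-1}\mathtt f^{c_K/2-1}$, where $x_i=\mathtt g$ if the sign following $c_i$ is $-$ and $x_i=\mathtt h$ if it is $+$. A cycle $C$ is of type $k$ if its descent is $\mathtt f^{c_1/2-1}x_1\cdots x_{k-1}\mathtt f^{c_k/2-1}$. Direction graphs. Let $A_1=\begin{pmatrix}0&1\\1&0\end{pmatrix}$, $A_2=\begin{pmatrix}1&0\\0&1\end{pmatrix}$, $A_3=\begin{pmatrix}-1&0\\0&1\end{pmatrix}$, $A_4=\begin{pmatrix}0&-1\\1&0\end{pmatrix}$, and $A_{i+4}=-A_i$ for $i=1,\ldots,4$. A move of a skew $(r,s)$-leaper, $r<s$, by a translation $v$ has (skew) direction $i\in\{1,\ldots,8\}$ and direction matrix $A_i$ if $v^T=A_i\binom rs$. A direction graph is a symmetric directed graph whose arcs are labeled with skew directions so that the sum of the associated direction matrices over every simple directed cycle (including two-cycles) is zero. Two direction graphs are the same if there is a label-preserving isomorphism between them. A simple cycle of a skew leaper is trivial if the sum of the direction matrices of its moves (in either orientation) is the zero matrix. The direction graph extracted from a trivial cycle $D$ has the squares of $D$ as vertices and, for each pair of squares $a,b$ consecutive in $D$, an arc from $a$ to $b$ and an arc from $b$ to $a$, each labeled with the direction of the corresponding move. "Depends only on" means that it is the same for all leapers $L$ and cycles $D$ with the same data. *)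

theory Defs
  imports "HOL-Analysis.Analysis"
begin

text \<open>Squares are identified with their centers. The proportions of leapers and frames are
  nonnegative integers; they are kept in \<^typ>\<open>int\<close> so that no coercions and no truncated
  subtraction occur.\<close>

type_synonym square = "int \<times> int"

definition leaper_moves :: "int \<Rightarrow> int \<Rightarrow> square set" where
  "leaper_moves p q =
    {(p, q), (p, - q), (- p, q), (- p, - q), (q, p), (q, - p), (- q, p), (- q, - p)}"

definition basic :: "int \<Rightarrow> int \<Rightarrow> bool" where
  "basic p q \<longleftrightarrow> odd (p + q) \<and> gcd p q = 1"

definition skew :: "int \<Rightarrow> int \<Rightarrow> bool" where
  "skew p q \<longleftrightarrow> p \<noteq> 0 \<and> q \<noteq> 0 \<and> p \<noteq> q"

text \<open>A simple cycle is given by the list of its squares, read cyclically from some starting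
  square in one of the two orientations.\<close>

definition leaper_cycle :: "int \<Rightarrow> int \<Rightarrow> square set \<Rightarrow> square list \<Rightarrow> bool" where
  "leaper_cycle p q B c \<longleftrightarrow>
     3 \<le> length c \<and> distinct c \<and> set c \<subseteq> B \<and>
     (\<forall>k < length c. c ! (Suc k mod length c) - c ! k \<in> leaper_moves p q)"

text \<open>The \<open>s \<times> s\<close> board centered at the origin; it is used for odd \<open>s\<close> only.\<close>

definition board :: "int \<Rightarrow> square set" where
  "board s = {(x, y). 2 * max \<bar>x\<bar> \<bar>y\<bar> < s}"

definition rot :: "square \<Rightarrow> square" where
  "rot z = (- snd z, fst z)"

text \<open>The directions E, NE, N, NW, W, SW, S, SE are numbered 0 to 7; \<open>dir_vec i\<close> below is the
  vector $u_i$.\<close>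

definition frame_section :: "int \<Rightarrow> int \<Rightarrow> nat \<Rightarrow> square set" where
  "frame_section m n i = (rot ^^ (i div 2)) `
     (if even i
      then {(x, y). n - m < 2 * x \<and> 2 * x < m + n \<and> 2 * \<bar>y\<bar> < n - m}
      else {(x, y). n - m < 2 * x \<and> 2 * x < m + n \<and> n - m < 2 * y \<and> 2 * y < m + n})"

definition dir_vec :: "nat \<Rightarrow> square" where
  "dir_vec i = (rot ^^ (i div 2)) (if even i then (1, 0) else (1, 1))"

datatype lifting = Lf | Lg | Lh

fun lift_frame :: "lifting \<Rightarrow> int \<times> int \<Rightarrow> int \<times> int" where
  "lift_frame Lf (m, n) = (m, 2 * m + n)"
| "lift_frame Lg (m, n) = (n, 2 * n - m)"
| "lift_frame Lh (m, n) = (n, m + 2 * n)"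

text \<open>The translation $v_i$ used in direction \<open>i\<close> when lifting from the \<open>(m, n)\<close>-frame.\<close>

fun lift_coeff :: "lifting \<Rightarrow> int \<times> int \<Rightarrow> nat \<Rightarrow> int" where
  "lift_coeff Lf (m, n) i = (if even i then m + n else m)"
| "lift_coeff Lg (m, n) i = (if even i then n - m else n)"
| "lift_coeff Lh (m, n) i = (if even i then m + n else n)"

definition lift_vec :: "lifting \<Rightarrow> int \<times> int \<Rightarrow> nat \<Rightarrow> square" where
  "lift_vec t F i =
     (lift_coeff t F i * fst (dir_vec i), lift_coeff t F i * snd (dir_vec i))"

definition lift_squares :: "lifting \<Rightarrow> int \<times> int \<Rightarrow> square set \<Rightarrow> square set" where
  "lift_squares t F S =
     (\<Union>i<8. (\<lambda>z. z + lift_vec t F i) ` S \<inter>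
        frame_section (fst (lift_frame t F)) (snd (lift_frame t F)) i)"

text \<open>Strings of liftings are applied from right to left, starting from a frame \<open>F\<close>.\<close>

definition lift_frames :: "lifting list \<Rightarrow> int \<times> int \<Rightarrow> int \<times> int" where
  "lift_frames es F = foldr lift_frame es F"

fun lift_squares_list :: "lifting list \<Rightarrow> int \<times> int \<Rightarrow> square set \<Rightarrow> square set" where
  "lift_squares_list [] F S = S"
| "lift_squares_list (t # ts) F S = lift_squares t (lift_frames ts F) (lift_squares_list ts F S)"

text \<open>In each case the four rotations are applied to one subboard of each of the two kinds: the
  northeastern corner and the subboard adjacent by side to the hole from the east; respectively,
  the middle of the eastern side and the subboard adjacent to the northeastern corner of the
  hole.\<close>

definition shell :: "int \<Rightarrow> int \<Rightarrow> square set" where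
  "shell m n = (\<Union>k<4. (rot ^^ k) `
     (if n \<le> 2 * m then
        {(x, y). 3 * m - n < 2 * x \<and> 2 * x < m + n \<and> 3 * m - n < 2 * y \<and> 2 * y < m + n} \<union>
        {(x, y). n - m < 2 * x \<and> 2 * x < 3 * (n - m) \<and> 2 * \<bar>y\<bar> < n - m}
      else if n \<le> 3 * m then
        {(x, y). 3 * n - 5 * m < 2 * x \<and> 2 * x < m + n \<and> 2 * \<bar>y\<bar> < 3 * m - n} \<union>
        {(x, y). n - m < 2 * x \<and> 2 * x < 5 * m - n \<and> n - m < 2 * y \<and> 2 * y < 5 * m - n}
      else {}))"

definition shell_cycle :: "int \<Rightarrow> int \<Rightarrow> square list \<Rightarrow> bool" where
  "shell_cycle m n c \<longleftrightarrow> leaper_cycle m n (shell m n) c \<and> length c = 8"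

definition leaper_descent :: "int \<Rightarrow> int \<Rightarrow> lifting list \<Rightarrow> bool" where
  "leaper_descent p q es \<longleftrightarrow> lift_frames es (1, 2) = (p, q)"

text \<open>\<open>C\<close> is a cycle of the \<open>(p, q)\<close>-leaper, whose descent is \<open>e @ d\<close>, and is obtained by the
  liftings \<open>e\<close> from the shell cycle \<open>C'\<close> of the frame whose leaper has descent \<open>d\<close>. Within a
  frame, a cycle is determined by its set of squares.\<close>

definition cycle_from_shell ::
  "int \<Rightarrow> int \<Rightarrow> square list \<Rightarrow> lifting list \<Rightarrow> lifting list \<Rightarrow> square list \<Rightarrow> bool" where
  "cycle_from_shell p q C e d C' \<longleftrightarrow>
     leaper_cycle p q (board (p + q)) C \<and> leaper_descent p q (e @ d) \<and>
     (case lift_frames d (1, 2) of (m, n) \<Rightarrow>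
        shell_cycle m n C' \<and> set C = lift_squares_list e (m, n) (set C'))"

definition cycle_descent :: "int \<Rightarrow> int \<Rightarrow> square list \<Rightarrow> lifting list \<Rightarrow> bool" where
  "cycle_descent p q C e \<longleftrightarrow> (\<exists>d C'. cycle_from_shell p q C e d C')"

text \<open>The argument is the remaining part $e_{j+1} \ldots e_l$ of the descent of the leaper.\<close>

fun second_leaper :: "lifting list \<Rightarrow> int \<times> int" where
  "second_leaper [] = (0, 1)"
| "second_leaper (x # d) = lift_frames d (1, 2)"

text \<open>A cycle is split into eight paths, given as a function on the directions 0 to 7; indices
  are read modulo 8.\<close>

type_synonym split_cycle = "nat \<Rightarrow> square list"

fun lift_path :: "lifting \<Rightarrow> split_cycle \<Rightarrow> nat \<Rightarrow> square list" where
  "lift_path Lf a i =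
     (if even i
      then rev (a ((i + 5) mod 8)) @ rev (a ((i + 4) mod 8)) @ rev (a ((i + 3) mod 8))
      else a i)"
| "lift_path Lg a i =
     (if even i
      then a i
      else rev (a ((i + 5) mod 8)) @ rev (a ((i + 4) mod 8)) @ rev (a ((i + 3) mod 8)))"
| "lift_path Lh a i =
     (if even i
      then rev (a ((i + 6) mod 8)) @ rev (a ((i + 5) mod 8)) @ rev (a ((i + 4) mod 8)) @
           rev (a ((i + 3) mod 8)) @ rev (a ((i + 2) mod 8))
      else a ((i + 7) mod 8) @ a i @ a ((i + 1) mod 8))"

definition lift_split :: "lifting \<Rightarrow> int \<times> int \<Rightarrow> split_cycle \<Rightarrow> split_cycle" where
  "lift_split t F a = (\<lambda>i. map (\<lambda>z. z + lift_vec t F i) (lift_path t a i))"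

fun lift_split_list :: "lifting list \<Rightarrow> int \<times> int \<Rightarrow> split_cycle \<Rightarrow> split_cycle" where
  "lift_split_list [] F a = a"
| "lift_split_list (t # ts) F a = lift_split t (lift_frames ts F) (lift_split_list ts F a)"

text \<open>\<open>D\<close> is the canonical second leaper cycle, of the \<open>(r, s)\<close>-leaper, over the squares of the
  cycle \<open>C\<close> of the \<open>(p, q)\<close>-leaper. The descent of \<open>C\<close> and \<open>D\<close> is \<open>e\<close>, that of the
  \<open>(p, q)\<close>-leaper is \<open>e @ d\<close>, and \<open>a\<close> is the canonical second leaper cycle over the squares of
  the underlying shell cycle.\<close>

definition canonical_second_cycle ::
  "int \<Rightarrow> int \<Rightarrow> square list \<Rightarrow> lifting list \<Rightarrow> lifting list \<Rightarrow> int \<Rightarrow> int \<Rightarrow> square list \<Rightarrow> bool"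
where
  "canonical_second_cycle p q C e d r s D \<longleftrightarrow>
     (r, s) = second_leaper d \<and>
     (\<exists>C' a. cycle_from_shell p q C e d C' \<and>
        (case lift_frames d (1, 2) of (m, n) \<Rightarrow>
           (\<forall>i<8. \<exists>z \<in> set C' \<inter> frame_section m n i. a i = [z]) \<and>
           D = concat (map (lift_split_list e (m, n) a) [0..<8])))"

text \<open>The case in which both leapers are skew basic; \<open>e\<close> is the descent and \<open>x\<close> the origin
  of \<open>D\<close>.\<close>

definition skew_second_cycle ::
  "int \<Rightarrow> int \<Rightarrow> square list \<Rightarrow> int \<Rightarrow> int \<Rightarrow> square list \<Rightarrow> lifting list \<Rightarrow> lifting \<Rightarrow> bool"
where
  "skew_second_cycle p q C r s D e x \<longleftrightarrow>
     0 < p \<and> p < q \<and> skew p q \<and> basic p q \<and>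
     skew r s \<and> basic r s \<and>
     (\<exists>d. d \<noteq> [] \<and> x = hd d \<and> canonical_second_cycle p q C e d r s D)"

text \<open>The signs are given as \<open>1\<close> and \<open>-1\<close>; there is one sign fewer than there are coefficients.\<close>

fun cf_value :: "nat list \<Rightarrow> int list \<Rightarrow> rat" where
  "cf_value (c # c' # cs) (\<sigma> # \<sigma>s) = of_nat c + of_int \<sigma> / cf_value (c' # cs) \<sigma>s"
| "cf_value (c # cs) _ = of_nat c"
| "cf_value [] _ = 0"

definition even_cf :: "int \<Rightarrow> int \<Rightarrow> nat list \<Rightarrow> int list \<Rightarrow> bool" where
  "even_cf p q cs \<sigma>s \<longleftrightarrow>
     length cs = Suc (length \<sigma>s) \<and> (\<forall>c \<in> set cs. even c) \<and> (\<forall>c \<in> set (tl cs). 0 < c) \<and>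
     set \<sigma>s \<subseteq> {1, - 1} \<and> cf_value cs \<sigma>s = of_int q / of_int p"

definition cf_convergent :: "nat \<Rightarrow> nat list \<Rightarrow> int list \<Rightarrow> rat" where
  "cf_convergent k cs \<sigma>s = cf_value (take k cs) (take (k - 1) \<sigma>s)"

text \<open>The string of an expansion whose first coefficient is positive, as it is whenever
  \<open>p < q\<close>.\<close>

fun cf_string :: "nat list \<Rightarrow> int list \<Rightarrow> lifting list" where
  "cf_string (c # c' # cs) (\<sigma> # \<sigma>s) =
     replicate (c div 2 - 1) Lf @ (if \<sigma> = - 1 then Lg else Lh) # cf_string (c' # cs) \<sigma>s"
| "cf_string (c # cs) _ = replicate (c div 2 - 1) Lf"
| "cf_string [] _ = []"

definition cycle_type :: "int \<Rightarrow> int \<Rightarrow> square list \<Rightarrow> nat \<Rightarrow> bool" where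
  "cycle_type p q C k \<longleftrightarrow>
     (\<exists>cs \<sigma>s. even_cf p q cs \<sigma>s \<and> 1 \<le> k \<and> k \<le> length cs \<and>
        cycle_descent p q C (cf_string (take k cs) (take (k - 1) \<sigma>s)))"

fun dir_matrix :: "nat \<Rightarrow> int^2^2" where
  "dir_matrix i =
     (if i = 1 then vector [vector [0, 1], vector [1, 0]]
      else if i = 2 then vector [vector [1, 0], vector [0, 1]]
      else if i = 3 then vector [vector [- 1, 0], vector [0, 1]]
      else if i = 4 then vector [vector [0, - 1], vector [1, 0]]
      else if i \<in> {5..8} then - dir_matrix (i - 4)
      else 0)"

declare dir_matrix.simps [simp del]

text \<open>The skew direction of a move by \<open>v\<close>; it is unique when \<open>0 < r < s\<close>.\<close>

definition move_direction :: "int \<Rightarrow> int \<Rightarrow> square \<Rightarrow> nat" where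
  "move_direction r s v =
     (THE i. i \<in> {1..8} \<and> dir_matrix i *v vector [r, s] = vector [fst v, snd v])"

definition trivial_cycle :: "int \<Rightarrow> int \<Rightarrow> square list \<Rightarrow> bool" where
  "trivial_cycle r s D \<longleftrightarrow>
     leaper_cycle r s UNIV D \<and>
     (\<Sum>k<length D. dir_matrix (move_direction r s (D ! (Suc k mod length D) - D ! k))) = 0"

text \<open>An arc \<open>(a, i, b)\<close> leads from \<open>a\<close> to \<open>b\<close> and has label \<open>i\<close>.\<close>

record 'v labeled_digraph =
  dg_verts :: "'v set"
  dg_arcs :: "('v \<times> nat \<times> 'v) set"

text \<open>The simple directed cycle through the vertices \<open>vs\<close> along arcs labeled \<open>ls\<close>. Length 1 is
  allowed, so a direction graph has no loops; parallel arcs of a direction graph coincide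
  because each of them forms a two-cycle with an opposite arc.\<close>

definition simple_dicycle :: "'v labeled_digraph \<Rightarrow> 'v list \<Rightarrow> nat list \<Rightarrow> bool" where
  "simple_dicycle G vs ls \<longleftrightarrow>
     vs \<noteq> [] \<and> distinct vs \<and> length ls = length vs \<and>
     (\<forall>k < length vs. (vs ! k, ls ! k, vs ! (Suc k mod length vs)) \<in> dg_arcs G)"

definition direction_graph :: "'v labeled_digraph \<Rightarrow> bool" where
  "direction_graph G \<longleftrightarrow>
     dg_arcs G \<subseteq> dg_verts G \<times> {1..8} \<times> dg_verts G \<and>
     (\<forall>a i b. (a, i, b) \<in> dg_arcs G \<longrightarrow> (\<exists>j. (b, j, a) \<in> dg_arcs G)) \<and>
     (\<forall>vs ls. simple_dicycle G vs ls \<longrightarrow> sum_list (map dir_matrix ls) = 0)"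

definition same_direction_graph :: "'v labeled_digraph \<Rightarrow> 'w labeled_digraph \<Rightarrow> bool" where
  "same_direction_graph G H \<longleftrightarrow>
     (\<exists>\<phi>. bij_betw \<phi> (dg_verts G) (dg_verts H) \<and>
        (\<forall>a \<in> dg_verts G. \<forall>b \<in> dg_verts G. \<forall>i.
           (a, i, b) \<in> dg_arcs G \<longleftrightarrow> (\<phi> a, i, \<phi> b) \<in> dg_arcs H))"

definition extracted_graph :: "int \<Rightarrow> int \<Rightarrow> square list \<Rightarrow> square labeled_digraph" where
  "extracted_graph r s D =
     \<lparr>dg_verts = set D,
      dg_arcs = (\<Union>k<length D. let a = D ! k; b = D ! (Suc k mod length D) in
        {(a, move_direction r s (b - a), b), (b, move_direction r s (a - b), a)})\<rparr>"

end

theory Submission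
  imports Defs
begin

text \<open>The squares of a shell cycle of the \<open>(m, n)\<close>-frame are \<open>c\<^sub>i + v\<close> for a common vector \<open>v\<close>,
  where \<open>c\<^sub>i\<close> is \<open>(n - m) u\<^sub>i\<close> for even and \<open>m u\<^sub>i\<close> for odd \<open>i\<close> (\<open>shell_cycle_centers\<close>). When the
  frame is the lift by \<open>x\<close>, of type \<open>Lg\<close> or \<open>Lh\<close>, of the \<open>(r, s)\<close>-frame, the differences of
  consecutive \<open>c\<^sub>i\<close> are the eight moves of the \<open>(r, s)\<close>-leaper, in an order that depends only on \<open>x\<close>.
  Under lifting, the moves inside the eight paths are preserved or reversed, and the moves that join
  consecutive paths are preserved up to a permutation. The latter rests on an invariant: the first
  square of path \<open>i\<close> is reached from the last square of path \<open>i + 5\<close> by a fixed move of the leaper of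
  the frame. Hence the cyclic string of directions of \<open>D\<close> is a function of \<open>e\<close> and \<open>x\<close>
  (\<open>labeled_split_lift\<close>, \<open>labeled_cycle_descent\<close>). Each path stays within its section, so \<open>D\<close> is
  simple, and the extracted graph is determined by the string (\<open>same_direction_graph_labeled\<close>).

  The computation of the directions is valid for arbitrary integers \<open>r\<close> and \<open>s\<close>. Running it with
  \<open>(r, s) = (1, 0)\<close> and \<open>(0, 1)\<close> yields two closed walks with the same directions as \<open>D\<close>, and the
  matrix whose columns are the \<open>k\<close>-th squares of these walks is a potential: its increments are the
  direction matrices of the moves of \<open>D\<close>. All cycle sums therefore telescope to zero, so \<open>D\<close> is
  trivial and the extracted graph is a direction graph.

  For the formulation by continued fractions, the descent of a cycle must be recovered from the
  cycle. Descents of leapers are unique since the three liftings produce disjoint ranges of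
  proportions, so two descents of one cycle are prefixes of one string; they coincide because the
  number of squares grows strictly with the length of the prefix (\<open>cycle_descent_unique\<close>). The
  uniqueness of even continued fractions then shows that the convergent determines \<open>e\<close> and that the
  sign which follows it determines \<open>x\<close> (\<open>skew_second_cycle_type\<close>, \<open>cf_convergent_determines\<close>).\<close>

section \<open>Skew directions and direction matrices\<close>

text \<open>The move of the \<open>(r, s)\<close>-leaper in skew direction \<open>i\<close>. The definition makes sense for all
  integers \<open>r\<close>, \<open>s\<close>, also when the eight moves do not differ; the degenerate cases \<open>(1, 0)\<close> and
  \<open>(0, 1)\<close> give the columns of the direction matrices.\<close>

definition dir_move :: "int \<Rightarrow> int \<Rightarrow> nat \<Rightarrow> square" where
  "dir_move r s i =
     (if i = 1 then (s, r) else if i = 2 then (r, s) else if i = 3 then (- r, s)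
      else if i = 4 then (- s, r) else if i = 5 then (- s, - r) else if i = 6 then (- r, - s)
      else if i = 7 then (r, - s) else (s, - r))"

text \<open>The direction of the reversed move.\<close>

definition opposite :: "nat \<Rightarrow> nat" where
  "opposite i = (if i \<le> 4 then i + 4 else i - 4)"

lemma directions_cases:
  assumes "i \<in> {1..8::nat}"
  obtains "i = 1" | "i = 2" | "i = 3" | "i = 4" | "i = 5" | "i = 6" | "i = 7" | "i = 8"
  using assms by fastforce

lemma opposite_in [simp]: "i \<in> {1..8} \<Longrightarrow> opposite i \<in> {1..8}"
  by (auto simp: opposite_def)

text \<open>The form in which the simplifier meets the previous fact, as it turns \<open>1\<close> into \<open>Suc 0\<close>.\<close>

lemmas opposite_in_Suc [simp] = opposite_in[unfolded One_nat_def]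

lemma dir_move_opposite [simp]: "i \<in> {1..8} \<Longrightarrow> dir_move r s (opposite i) = - dir_move r s i"
  by (erule directions_cases) (simp_all add: opposite_def dir_move_def)

lemma dir_move_in_leaper_moves: "dir_move r s i \<in> leaper_moves r s"
  by (simp add: dir_move_def leaper_moves_def)

lemma inj_on_dir_move:
  assumes "0 < r" "r < s"
  shows "inj_on (dir_move r s) {1..8}"
proof (rule inj_onI)
  fix i j :: nat
  assume "i \<in> {1..8}" "j \<in> {1..8}" and eq: "dir_move r s i = dir_move r s j"
  then show "i = j"
    by (elim directions_cases) (use assms eq in \<open>simp_all add: dir_move_def\<close>)
qed

text \<open>The matrix with columns \<open>u\<close> and \<open>v\<close>.\<close>

definition column_matrix :: "square \<Rightarrow> square \<Rightarrow> int^2^2" where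
  "column_matrix u v = vector [vector [fst u, fst v], vector [snd u, snd v]]"

lemma column_matrix_diff:
  "column_matrix (u - u') (v - v') = column_matrix u v - column_matrix u' v'"
  by (simp add: column_matrix_def vec_eq_iff forall_2 vector_2)

lemma column_matrix_uminus: "column_matrix (- u) (- v) = - column_matrix u v"
  by (simp add: column_matrix_def vec_eq_iff forall_2 vector_2)

lemma dir_matrix_columns:
  "i \<in> {1..8} \<Longrightarrow> dir_matrix i = column_matrix (dir_move 1 0 i) (dir_move 0 1 i)"
  by (erule directions_cases)
    (simp_all add: dir_matrix.simps column_matrix_def dir_move_def vec_eq_iff forall_2 vector_2)

lemma dir_matrix_opposite: "i \<in> {1..8} \<Longrightarrow> dir_matrix (opposite i) = - dir_matrix i"
  by (simp add: dir_matrix_columns column_matrix_uminus del: atLeastAtMost_iff)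

lemma dir_matrix_mult:
  "i \<in> {1..8} \<Longrightarrow>
   dir_matrix i *v vector [r, s] = vector [fst (dir_move r s i), snd (dir_move r s i)]"
  by (erule directions_cases)
    (simp_all add: dir_matrix_columns column_matrix_def dir_move_def vec_eq_iff forall_2 vector_2
      matrix_vector_mult_def sum_2)

lemma move_direction_dir_move:
  assumes "0 < r" "r < s" "i \<in> {1..8}"
  shows "move_direction r s (dir_move r s i) = i"
  unfolding move_direction_def
proof (rule the_equality)
  show "i \<in> {1..8} \<and>
      dir_matrix i *v vector [r, s] = vector [fst (dir_move r s i), snd (dir_move r s i)]"
    using assms dir_matrix_mult by blast
next
  fix j assume j: "j \<in> {1..8} \<and>
      dir_matrix j *v vector [r, s] = vector [fst (dir_move r s i), snd (dir_move r s i)]"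
  then have "(vector [fst (dir_move r s j), snd (dir_move r s j)] :: int^2) =
      vector [fst (dir_move r s i), snd (dir_move r s i)]"
    using dir_matrix_mult by metis
  then have "dir_move r s j = dir_move r s i"
    by (simp add: vec_eq_iff forall_2 vector_2 prod_eq_iff)
  then show "j = i"
    using inj_on_dir_move[OF assms(1,2)] j assms(3) by (meson inj_onD)
qed

section \<open>Differences along a path\<close>

text \<open>The differences of consecutive elements of a list.\<close>

fun steps :: "'a::ab_group_add list \<Rightarrow> 'a list" where
  "steps (x # y # zs) = (y - x) # steps (y # zs)"
| "steps _ = []"

lemma length_steps [simp]: "length (steps xs) = length xs - 1"
  by (induction xs rule: steps.induct) auto

lemma steps_nth: "Suc k < length xs \<Longrightarrow> steps xs ! k = xs ! Suc k - xs ! k"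
proof (induction xs arbitrary: k rule: steps.induct)
  case (1 x y zs)
  then show ?case by (cases k) auto
qed auto

lemma steps_append:
  "xs \<noteq> [] \<Longrightarrow> ys \<noteq> [] \<Longrightarrow> steps (xs @ ys) = steps xs @ (hd ys - last xs) # steps ys"
proof (induction xs rule: steps.induct)
  case ("2_2" v)
  then show ?case by (cases ys) auto
qed auto

lemma steps_translate: "steps (map (\<lambda>z. z + v) xs) = steps xs"
  by (induction xs rule: steps.induct) auto

lemma steps_rev: "steps (rev xs) = map uminus (rev (steps xs))"
proof (induction xs rule: steps.induct)
  case (1 x y zs)
  have "steps (rev (x # y # zs)) = steps (rev (y # zs) @ [x])"
    by simp
  also have "\<dots> = steps (rev (y # zs)) @ [x - y]"
    by (subst steps_append) auto
  finally show ?case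
    using 1 by simp
qed auto

section \<open>Lifting of direction labels\<close>

lemma rot_power [simp]:
  "(rot ^^ 2) z = - z" "(rot ^^ 3) z = (snd z, - fst z)"
  by (simp_all add: rot_def eval_nat_numeral prod_eq_iff)

lemma dir_vec_simps [simp]:
  "dir_vec 0 = (1, 0)" "dir_vec (Suc 0) = (1, 1)" "dir_vec 2 = (0, 1)" "dir_vec 3 = (- 1, 1)"
  "dir_vec 4 = (- 1, 0)" "dir_vec 5 = (- 1, - 1)" "dir_vec 6 = (0, - 1)" "dir_vec 7 = (1, - 1)"
  by (simp_all add: dir_vec_def rot_def)

lemma less_8_cases:
  assumes "i < (8::nat)"
  obtains "i = 0" | "i = 1" | "i = 2" | "i = 3" | "i = 4" | "i = 5" | "i = 6" | "i = 7"
  using assms by fastforce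

lemma all_less_8:
  "(\<forall>i<8. P i) \<longleftrightarrow> P 0 \<and> P (1::nat) \<and> P 2 \<and> P 3 \<and> P 4 \<and> P 5 \<and> P 6 \<and> P 7"
  by (auto elim: less_8_cases)

text \<open>The move of the \<open>(m, n)\<close>-leaper, for \<open>F = (m, n)\<close>, that joins the last square of the path in
  section \<open>i + 5\<close> to the first square of the path in section \<open>i\<close>.\<close>

definition closing_vec :: "int \<times> int \<Rightarrow> nat \<Rightarrow> square" where
  "closing_vec F i = (rot ^^ (i div 2)) (if even i then (snd F, fst F) else F)"

lemma closing_vec_simps [simp]:
  "closing_vec (m, n) 0 = (n, m)" "closing_vec (m, n) (Suc 0) = (m, n)"
  "closing_vec (m, n) 2 = (- m, n)" "closing_vec (m, n) 3 = (- n, m)"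
  "closing_vec (m, n) 4 = (- n, - m)" "closing_vec (m, n) 5 = (- m, - n)"
  "closing_vec (m, n) 6 = (m, - n)" "closing_vec (m, n) 7 = (n, - m)"
  by (simp_all add: closing_vec_def rot_def)

text \<open>The labels of a path traversed backwards.\<close>

abbreviation reversed :: "nat list \<Rightarrow> nat list" where
  "reversed w \<equiv> map opposite (rev w)"

text \<open>A split cycle \<open>a\<close> is labeled by the strings \<open>w i\<close> of directions along its paths \<open>a i\<close> and the
  directions \<open>g i\<close> of its joints, the moves from the last square of \<open>a i\<close> to the first square of
  \<open>a (i + 1)\<close>. The labels of a lifted cycle are obtained from these alone: a joint between
  two paths that are concatenated becomes an internal move, reversed if the paths are traversed
  backwards.\<close>

fun lift_labels :: "lifting \<Rightarrow> (nat \<Rightarrow> nat list) \<Rightarrow> (nat \<Rightarrow> nat) \<Rightarrow> nat \<Rightarrow> nat list" where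
  "lift_labels Lf w g i =
     (if even i
      then reversed (w ((i + 5) mod 8)) @ opposite (g ((i + 4) mod 8)) #
           reversed (w ((i + 4) mod 8)) @ opposite (g ((i + 3) mod 8)) #
           reversed (w ((i + 3) mod 8))
      else w i)"
| "lift_labels Lg w g i =
     (if even i
      then w i
      else reversed (w ((i + 5) mod 8)) @ opposite (g ((i + 4) mod 8)) #
           reversed (w ((i + 4) mod 8)) @ opposite (g ((i + 3) mod 8)) #
           reversed (w ((i + 3) mod 8)))"
| "lift_labels Lh w g i =
     (if even i
      then reversed (w ((i + 6) mod 8)) @ opposite (g ((i + 5) mod 8)) #
           reversed (w ((i + 5) mod 8)) @ opposite (g ((i + 4) mod 8)) #
           reversed (w ((i + 4) mod 8)) @ opposite (g ((i + 3) mod 8)) #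
           reversed (w ((i + 3) mod 8)) @ opposite (g ((i + 2) mod 8)) #
           reversed (w ((i + 2) mod 8))
      else w ((i + 7) mod 8) @ g ((i + 7) mod 8) # w i @ g i # w ((i + 1) mod 8))"

text \<open>The joints keep their directions under \<open>Lf\<close> and \<open>Lg\<close>; under \<open>Lh\<close> the joints 0 and 7, 1 and 2,
  3 and 4, 5 and 6 trade theirs.\<close>

fun lift_joints :: "lifting \<Rightarrow> (nat \<Rightarrow> nat) \<Rightarrow> nat \<Rightarrow> nat" where
  "lift_joints Lh g i = (if even i then g ((i + 7) mod 8) else g ((i + 1) mod 8))"
| "lift_joints _ g i = g i"

fun lift_labeling ::
  "lifting list \<Rightarrow> (nat \<Rightarrow> nat list) \<times> (nat \<Rightarrow> nat) \<Rightarrow> (nat \<Rightarrow> nat list) \<times> (nat \<Rightarrow> nat)" where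
  "lift_labeling [] l = l"
| "lift_labeling (t # ts) l =
     (let (w, g) = lift_labeling ts l in (lift_labels t w g, lift_joints t g))"

definition labels_ok :: "(nat \<Rightarrow> nat list) \<Rightarrow> (nat \<Rightarrow> nat) \<Rightarrow> bool" where
  "labels_ok w g \<longleftrightarrow> (\<forall>i<8. set (w i) \<subseteq> {1..8} \<and> g i \<in> {1..8})"

text \<open>The split cycle \<open>a\<close> within the frame \<open>F\<close> has the labels \<open>w\<close>, \<open>g\<close> as a cycle of the
  \<open>(r, s)\<close>-leaper. The last conjunct is what makes the labeling propagate: it relates the ends of
  paths that do not follow each other in the cycle, and it determines the joints of the lifted
  cycle.\<close>

definition labeled_split ::
  "int \<Rightarrow> int \<Rightarrow> int \<times> int \<Rightarrow> split_cycle \<Rightarrow> (nat \<Rightarrow> nat list) \<Rightarrow> (nat \<Rightarrow> nat) \<Rightarrow> bool" where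
  "labeled_split r s F a w g \<longleftrightarrow>
     (\<forall>i<8. a i \<noteq> [] \<and> steps (a i) = map (dir_move r s) (w i) \<and>
        hd (a ((i + 1) mod 8)) - last (a i) = dir_move r s (g i) \<and>
        hd (a i) - last (a ((i + 5) mod 8)) = closing_vec F i)"

lemma labels_ok_lift:
  assumes "labels_ok w g"
  shows "labels_ok (lift_labels t w g) (lift_joints t g)"
proof -
  have w: "set (w j) \<subseteq> {1..8}" and g: "g j \<in> {1..8}" if "j < 8" for j
    using assms that by (auto simp: labels_ok_def)
  have rw: "set (reversed (w j)) \<subseteq> {1..8}" and og: "opposite (g j) \<in> {1..8}" if "j < 8" for j
    using w[OF that] g[OF that] opposite_in by (auto simp del: atLeastAtMost_iff)
  show ?thesis
    unfolding labels_ok_def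
    by (cases t) (use w g rw og in \<open>simp_all del: atLeastAtMost_iff One_nat_def set_map set_rev\<close>)
qed

lemma steps_reversed:
  assumes "steps u = map (dir_move r s) l" "set l \<subseteq> {1..8}"
  shows "steps (rev u) = map (dir_move r s) (reversed l)"
proof -
  have "- dir_move r s i = dir_move r s (opposite i)" if "i \<in> set l" for i
    using dir_move_opposite assms(2) that by (metis subsetD)
  then show ?thesis
    using assms(1) by (simp add: steps_rev rev_map)
qed

lemma lift_split_ends:
  assumes ne: "\<And>i. i < 8 \<Longrightarrow> a i \<noteq> []" and "i < 8"
  shows "hd (lift_split Lf F a i) =
      (if even i then last (a ((i + 5) mod 8)) else hd (a i)) + lift_vec Lf F i"
    and "last (lift_split Lf F a i) =
      (if even i then hd (a ((i + 3) mod 8)) else last (a i)) + lift_vec Lf F i"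
    and "hd (lift_split Lg F a i) =
      (if even i then hd (a i) else last (a ((i + 5) mod 8))) + lift_vec Lg F i"
    and "last (lift_split Lg F a i) =
      (if even i then last (a i) else hd (a ((i + 3) mod 8))) + lift_vec Lg F i"
    and "hd (lift_split Lh F a i) =
      (if even i then last (a ((i + 6) mod 8)) else hd (a ((i + 7) mod 8))) + lift_vec Lh F i"
    and "last (lift_split Lh F a i) =
      (if even i then hd (a ((i + 2) mod 8)) else last (a ((i + 1) mod 8))) + lift_vec Lh F i"
  using assms
  by (simp_all add: lift_split_def hd_map last_map hd_append last_append hd_rev last_rev)

text \<open>The closing property of the lifted cycle holds because the two squares that it compares are
  images of one and the same square under two translations. A new joint compares images of two
  squares whose difference is an old joint minus a closing vector; the closing vector cancels
  against the translations. The integers \<open>r\<close>, \<open>s\<close> and the frame \<open>F\<close> may be degenerate.\<close>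

lemma labeled_split_lift:
  assumes a: "labeled_split r s F a w g" and ok: "labels_ok w g"
  shows "labeled_split r s (lift_frame t F) (lift_split t F a) (lift_labels t w g) (lift_joints t g)"
proof -
  obtain m n where F: "F = (m, n)" by (cases F)
  have ne: "a i \<noteq> []" if "i < 8" for i
    using a that by (auto simp: labeled_split_def)
  have w: "steps (a i) = map (dir_move r s) (w i)" if "i < 8" for i
    using a that by (auto simp: labeled_split_def)
  have rw: "steps (rev (a i)) = map (dir_move r s) (reversed (w i))" if "i < 8" for i
    using w[OF that] ok that by (intro steps_reversed) (auto simp: labels_ok_def)
  have g: "hd (a ((i + 1) mod 8)) - last (a i) = dir_move r s (g i)" if "i < 8" for i
    using a that by (auto simp: labeled_split_def)
  have og: "last (a i) - hd (a ((i + 1) mod 8)) = dir_move r s (opposite (g i))" if "i < 8" for i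
    using g[OF that, symmetric] ok that by (simp add: labels_ok_def del: atLeastAtMost_iff)
  have k: "hd (a i) - last (a ((i + 5) mod 8)) = closing_vec F i" if "i < 8" for i
    using a that by (auto simp: labeled_split_def)
  \<comment> \<open>Rewriting all last squares by first squares turns the joints into identities of vectors.\<close>
  have K: "last (a ((i + 5) mod 8)) = hd (a i) - closing_vec F i" if "i < 8" for i
    using k[OF that] by (simp add: algebra_simps)
  note K' = K[of 0, simplified] K[of 1, simplified] K[of 2, simplified] K[of 3, simplified]
    K[of 4, simplified] K[of 5, simplified] K[of 6, simplified] K[of 7, simplified]
  have "lift_path t a i \<noteq> []" if "i < 8" for i
    using that ne by (cases t) auto
  moreover have "steps (lift_path t a i) = map (dir_move r s) (lift_labels t w g i)" if "i < 8" for i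
  proof (cases t)
    case Lf
    then show ?thesis using that
      using og[of "(i + 4) mod 8"] og[of "(i + 3) mod 8"]
      by (simp add: steps_append ne w rw hd_rev last_rev mod_simps add.commute)
  next
    case Lg
    then show ?thesis using that
      using og[of "(i + 4) mod 8"] og[of "(i + 3) mod 8"]
      by (simp add: steps_append ne w rw hd_rev last_rev mod_simps add.commute)
  next
    case Lh
    then show ?thesis using that
      using og[of "(i + 5) mod 8"] og[of "(i + 4) mod 8"] og[of "(i + 3) mod 8"]
        og[of "(i + 2) mod 8"] g[of "(i + 7) mod 8"] g[of i]
      by (simp add: steps_append ne w rw hd_rev last_rev mod_simps add.commute)
  qed
  moreover have "hd (lift_split t F a ((i + 1) mod 8)) - last (lift_split t F a i)
      = dir_move r s (lift_joints t g i)" if i: "i < 8" for i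
    by (cases t; rule less_8_cases[OF i])
      (simp_all add: lift_split_ends[OF ne] F lift_vec_def g[symmetric]
        K'[unfolded F closing_vec_simps] flip: numeral_2_eq_2)
  moreover have "hd (lift_split t F a i) - last (lift_split t F a ((i + 5) mod 8))
      = closing_vec (lift_frame t F) i" if i: "i < 8" for i
    by (cases t; rule less_8_cases[OF i])
      (simp_all add: lift_split_ends[OF ne] F lift_vec_def flip: numeral_2_eq_2)
  ultimately show ?thesis
    by (simp add: labeled_split_def lift_split_def steps_translate)
qed

lemma labeled_split_lift_list:
  assumes "labeled_split r s F a w g" "labels_ok w g"
  shows "labeled_split r s (lift_frames es F) (lift_split_list es F a)
      (fst (lift_labeling es (w, g))) (snd (lift_labeling es (w, g)))"
    and "labels_ok (fst (lift_labeling es (w, g))) (snd (lift_labeling es (w, g)))"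
proof (induction es)
  case Nil
  {
    case 1 show ?case using assms by (simp add: lift_frames_def)
  next
    case 2 show ?case using assms by simp
  }
next
  case (Cons t es)
  {
    case 1 show ?case
      using labeled_split_lift[OF Cons.IH, of t] by (simp add: lift_frames_def case_prod_beta)
  next
    case 2 show ?case
      using labels_ok_lift[OF Cons.IH(2), of t] by (simp add: case_prod_beta)
  }
qed

text \<open>The closed walk \<open>D\<close> has the directions \<open>ls\<close>, as moves of the \<open>(r, s)\<close>-leaper.\<close>

definition labeled_cycle :: "int \<Rightarrow> int \<Rightarrow> square list \<Rightarrow> nat list \<Rightarrow> bool" where
  "labeled_cycle r s D ls \<longleftrightarrow> D \<noteq> [] \<and> length ls = length D \<and> set ls \<subseteq> {1..8} \<and>
     (\<forall>k<length D. D ! (Suc k mod length D) - D ! k = dir_move r s (ls ! k))"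

text \<open>The labels of a labeled split cycle, in the order of traversal.\<close>

definition cycle_labels :: "(nat \<Rightarrow> nat list) \<times> (nat \<Rightarrow> nat) \<Rightarrow> nat list" where
  "cycle_labels l = concat (map (\<lambda>i. fst l i @ [snd l i]) [0..<8])"

lemma upt_0_8: "[0..<8] = [0, 1, 2, 3, 4, 5, 6, 7]"
  by (simp add: upt_rec)

lemma labeled_cycle_concat:
  assumes a: "labeled_split r s F a w g" and ok: "labels_ok w g"
  shows "labeled_cycle r s (concat (map a [0..<8])) (cycle_labels (w, g))"
proof -
  define D where "D = concat (map a [0..<8])"
  define ls where "ls = cycle_labels (w, g)"
  have ne: "a i \<noteq> []" and w: "steps (a i) = map (dir_move r s) (w i)"
    and g: "hd (a ((i + 1) mod 8)) - last (a i) = dir_move r s (g i)" if "i < 8" for i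
    using a that by (auto simp: labeled_split_def)
  note g' = g[of 0, simplified] g[of 1, simplified, folded numeral_2_eq_2]
    g[of 2, simplified] g[of 3, simplified] g[of 4, simplified] g[of 5, simplified]
    g[of 6, simplified] g[of 7, simplified]
  have D: "D = a 0 @ a 1 @ a 2 @ a 3 @ a 4 @ a 5 @ a 6 @ a 7"
    by (simp add: D_def upt_0_8)
  have ls: "ls = w 0 @ g 0 # w 1 @ g 1 # w 2 @ g 2 # w 3 @ g 3 # w 4 @ g 4 # w 5 @ g 5 #
      w 6 @ g 6 # w 7 @ [g 7]"
    by (simp add: ls_def cycle_labels_def upt_0_8)
  have "D \<noteq> []" "hd D = hd (a 0)"
    using ne by (simp_all add: D)
  have *: "steps (D @ [hd D]) = map (dir_move r s) ls"
    unfolding \<open>hd D = hd (a 0)\<close> unfolding D ls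
    by (simp add: steps_append ne w g' flip: numeral_2_eq_2)
  then have len: "length ls = length D"
    by (metis length_append_singleton length_steps length_map diff_Suc_1)
  have "D ! (Suc k mod length D) - D ! k = dir_move r s (ls ! k)" if "k < length D" for k
  proof -
    have "D ! (Suc k mod length D) = (D @ [hd D]) ! Suc k"
      using that \<open>D \<noteq> []\<close> by (cases "Suc k = length D") (auto simp: nth_append hd_conv_nth)
    then have "D ! (Suc k mod length D) - D ! k = steps (D @ [hd D]) ! k"
      using that by (simp add: steps_nth nth_append)
    then show ?thesis
      using that len by (simp add: *)
  qed
  moreover have "set ls \<subseteq> {1..8}"
    using ok by (simp add: ls labels_ok_def all_less_8)
  ultimately show ?thesis
    using \<open>D \<noteq> []\<close> len by (simp add: labeled_cycle_def D_def ls_def)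
qed

section \<open>Labels of canonical second leaper cycles\<close>

text \<open>The center of the subboard of the shell in section \<open>i\<close>; the formula is the same for both
  shapes of the shell. A shell cycle consists of the translates of the eight centers by one common
  vector.\<close>

definition subboard_center :: "int \<Rightarrow> int \<Rightarrow> nat \<Rightarrow> square" where
  "subboard_center m n i =
     ((if even i then n - m else m) * fst (dir_vec i),
      (if even i then n - m else m) * snd (dir_vec i))"

text \<open>The directions, as moves of the \<open>(r, s)\<close>-leaper, of the cycle through the eight subboard
  centers of the frame obtained from the \<open>(r, s)\<close>-frame by one lifting. Origin \<open>Lf\<close> does not occur,
  and its value is arbitrary.\<close>

fun origin_joints :: "lifting \<Rightarrow> nat \<Rightarrow> nat" where
  "origin_joints Lg i = [2, 5, 4, 7, 6, 1, 8, 3] ! i"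
| "origin_joints Lh i = [3, 4, 5, 6, 7, 8, 1, 2] ! i"
| "origin_joints Lf i = 1"

lemma labeled_split_shell:
  assumes "x \<noteq> Lf" "lift_frame x (r, s) = (m, n)" "\<And>i. i < 8 \<Longrightarrow> a i = [subboard_center m n i + v]"
  shows "labeled_split r s (m, n) a (\<lambda>_. []) (origin_joints x)"
    and "labels_ok (\<lambda>_. []) (origin_joints x)"
proof -
  show "labeled_split r s (m, n) a (\<lambda>_. []) (origin_joints x)"
    unfolding labeled_split_def all_less_8
    using assms(1,2)
    by (cases x) (auto simp: assms(3) subboard_center_def dir_move_def simp flip: numeral_2_eq_2)
  show "labels_ok (\<lambda>_. []) (origin_joints x)"
    unfolding labels_ok_def all_less_8
    by (cases x) simp_all
qed

text \<open>The directions of the canonical second leaper cycle of descent \<open>e\<close> and origin \<open>x\<close>.\<close>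

definition descent_labels :: "lifting list \<Rightarrow> lifting \<Rightarrow> nat list" where
  "descent_labels e x = cycle_labels (lift_labeling e (\<lambda>_. [], origin_joints x))"

text \<open>The labels do not depend on \<open>r\<close>, \<open>s\<close> and \<open>v\<close>, which are arbitrary here. The walk need not be
  a simple cycle.\<close>

lemma labeled_cycle_descent:
  assumes "x \<noteq> Lf" "lift_frame x (r, s) = (m, n)" "\<And>i. i < 8 \<Longrightarrow> a i = [subboard_center m n i + v]"
  shows "labeled_cycle r s (concat (map (lift_split_list e (m, n) a) [0..<8])) (descent_labels e x)"
proof -
  note base = labeled_split_shell[of x r s m n a v, OF assms]
  note lifted = labeled_split_lift_list[OF base, of e]
  show ?thesis
    using labeled_cycle_concat[OF lifted]
    by (simp only: descent_labels_def lift_frames_def prod.collapse)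
qed

section \<open>The extracted graph of a labeled cycle\<close>

lemma sum_cyclic_shift:
  fixes f :: "nat \<Rightarrow> 'a::comm_monoid_add"
  shows "(\<Sum>k<n. f (Suc k mod n)) = (\<Sum>k<n. f k)"
proof (cases n)
  case (Suc m)
  have "(\<Sum>k<n. f (Suc k mod n)) = (\<Sum>k<m. f (Suc k mod n)) + f 0"
    by (simp add: Suc)
  also have "(\<Sum>k<m. f (Suc k mod n)) = (\<Sum>k<m. f (Suc k))"
    by (intro sum.cong) (auto simp: Suc)
  finally show ?thesis
    by (simp only: Suc sum.lessThan_Suc_shift add.commute)
qed simp

text \<open>The arcs of the extracted graph, with squares replaced by their positions in the cycle.\<close>

definition index_arcs :: "nat list \<Rightarrow> (nat \<times> nat \<times> nat) set" where
  "index_arcs ls = (\<Union>k<length ls. let j = Suc k mod length ls in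
     {(k, ls ! k, j), (j, opposite (ls ! k), k)})"

lemma extracted_arcs:
  assumes "0 < r" "r < s" and D: "labeled_cycle r s D ls"
  shows "dg_arcs (extracted_graph r s D) = (\<lambda>(i, l, j). (D ! i, l, D ! j)) ` index_arcs ls"
proof -
  have len: "length ls = length D" and ls: "set ls \<subseteq> {1..8}"
    and mv: "\<And>k. k < length D \<Longrightarrow> D ! (Suc k mod length D) - D ! k = dir_move r s (ls ! k)"
    using D by (auto simp: labeled_cycle_def)
  have l: "ls ! k \<in> {1..8}" if "k < length D" for k
    using ls len that by (metis nth_mem subsetD)
  have 1: "move_direction r s (D ! (Suc k mod length D) - D ! k) = ls ! k" if "k < length D" for k
    using assms(1,2) l[OF that] by (simp add: mv[OF that] move_direction_dir_move)
  have 2: "move_direction r s (D ! k - D ! (Suc k mod length D)) = opposite (ls ! k)"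
    if "k < length D" for k
  proof -
    have "D ! k - D ! (Suc k mod length D) = dir_move r s (opposite (ls ! k))"
      using l[OF that] mv[OF that, symmetric] by (simp del: atLeastAtMost_iff)
    then show ?thesis
      using assms(1,2) opposite_in[OF l[OF that]] by (simp add: move_direction_dir_move)
  qed
  show ?thesis
    unfolding extracted_graph_def index_arcs_def Let_def image_UN len labeled_digraph.simps
    by (intro SUP_cong refl) (simp add: 1 2)
qed

lemma index_arcsD:
  assumes "(i, l, j) \<in> index_arcs ls" "set ls \<subseteq> {1..8}"
  shows "i < length ls" "j < length ls" "l \<in> {1..8}" "(j, opposite l, i) \<in> index_arcs ls"
proof -
  obtain k where k: "k < length ls" and c: "(i, l, j) = (k, ls ! k, Suc k mod length ls) \<or>
      (i, l, j) = (Suc k mod length ls, opposite (ls ! k), k)"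
    using assms(1) by (auto simp: index_arcs_def Let_def)
  have lk: "ls ! k \<in> {1..8}"
    using k assms(2) by (metis nth_mem subsetD)
  have "Suc k mod length ls < length ls"
    using k by (intro mod_less_divisor) linarith
  then show "i < length ls" "j < length ls"
    using c k by auto
  show "l \<in> {1..8}"
    using c lk opposite_in[OF lk] by (auto simp del: atLeastAtMost_iff)
  have "opposite (opposite (ls ! k)) = ls ! k"
    using lk by (auto simp: opposite_def)
  then show "(j, opposite l, i) \<in> index_arcs ls"
    using c k by (auto simp: index_arcs_def Let_def)
qed

text \<open>A matrix-valued potential on the vertices whose increments are the direction matrices of the
  arcs forces all cycle sums to vanish.\<close>

lemma dicycle_sum_potential:
  assumes pot: "\<And>a l b. (a, l, b) \<in> dg_arcs G \<Longrightarrow> P b - P a = dir_matrix l"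
    and c: "simple_dicycle G vs ls"
  shows "sum_list (map dir_matrix ls) = 0"
proof -
  have len: "length ls = length vs"
    using c by (simp add: simple_dicycle_def)
  have "sum_list (map dir_matrix ls) = (\<Sum>k<length vs. dir_matrix (ls ! k))"
    by (simp add: sum_list_sum_nth len atLeast0LessThan)
  also have "\<dots> = (\<Sum>k<length vs. P (vs ! (Suc k mod length vs)) - P (vs ! k))"
    using c by (intro sum.cong) (auto simp: simple_dicycle_def pot)
  also have "\<dots> = 0"
    using sum_cyclic_shift[of "\<lambda>k. P (vs ! k)" "length vs"] by (simp add: sum_subtractf)
  finally show ?thesis .
qed

text \<open>Closed walks with the same labels for the degenerate leapers \<open>(1, 0)\<close> and \<open>(0, 1)\<close> supply the
  two columns of such a potential.\<close>

lemma label_potential: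
  assumes "labeled_cycle 1 0 D1 ls" "labeled_cycle 0 1 D2 ls" "k < length ls"
  shows "column_matrix (D1 ! (Suc k mod length ls)) (D2 ! (Suc k mod length ls)) -
      column_matrix (D1 ! k) (D2 ! k) = dir_matrix (ls ! k)"
proof -
  have "ls ! k \<in> {1..8}"
    using assms(1,3) by (metis labeled_cycle_def nth_mem subsetD)
  moreover have "D1 ! (Suc k mod length ls) - D1 ! k = dir_move 1 0 (ls ! k)"
    "D2 ! (Suc k mod length ls) - D2 ! k = dir_move 0 1 (ls ! k)"
    using assms by (auto simp: labeled_cycle_def)
  ultimately show ?thesis
    by (metis column_matrix_diff dir_matrix_columns)
qed

lemma trivial_cycle_labeled:
  assumes "0 < r" "r < s" and D: "labeled_cycle r s D ls" and "distinct D" "3 \<le> length D"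
    and D12: "labeled_cycle 1 0 D1 ls" "labeled_cycle 0 1 D2 ls"
  shows "trivial_cycle r s D"
proof -
  have len: "length ls = length D" and ls: "set ls \<subseteq> {1..8}"
    and mv: "\<And>k. k < length D \<Longrightarrow> D ! (Suc k mod length D) - D ! k = dir_move r s (ls ! k)"
    using D by (auto simp: labeled_cycle_def)
  have "dir_matrix (move_direction r s (D ! (Suc k mod length D) - D ! k)) =
      column_matrix (D1 ! (Suc k mod length D)) (D2 ! (Suc k mod length D)) -
      column_matrix (D1 ! k) (D2 ! k)" if "k < length D" for k
  proof -
    have "ls ! k \<in> {1..8}"
      using ls len that by (metis nth_mem subsetD)
    then show ?thesis
      using label_potential[OF D12, of k] that len assms(1,2)
      by (simp add: mv move_direction_dir_move del: atLeastAtMost_iff)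
  qed
  then have "(\<Sum>k<length D.
      dir_matrix (move_direction r s (D ! (Suc k mod length D) - D ! k))) = 0"
    using sum_cyclic_shift[of "\<lambda>k. column_matrix (D1 ! k) (D2 ! k)" "length D"]
    by (simp add: sum_subtractf)
  then show ?thesis
    using assms(4,5) by (simp add: trivial_cycle_def leaper_cycle_def mv dir_move_in_leaper_moves)
qed

lemma direction_graph_labeled:
  assumes "0 < r" "r < s" and D: "labeled_cycle r s D ls" and "distinct D"
    and D12: "labeled_cycle 1 0 D1 ls" "labeled_cycle 0 1 D2 ls"
  shows "direction_graph (extracted_graph r s D)"
proof -
  let ?G = "extracted_graph r s D"
  have len: "length ls = length D" and ls: "set ls \<subseteq> {1..8}"
    using D by (auto simp: labeled_cycle_def)
  have V: "dg_verts ?G = set D"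
    by (simp add: extracted_graph_def)
  note arcs = extracted_arcs[OF assms(1-3)]
  have arcD: "\<exists>i j. a = D ! i \<and> b = D ! j \<and> (i, l, j) \<in> index_arcs ls"
    if "(a, l, b) \<in> dg_arcs ?G" for a l b
    using that by (auto simp: arcs)
  define ind where "ind = inv_into {..<length D} (nth D)"
  have ind: "ind (D ! i) = i" if "i < length D" for i
    unfolding ind_def using that \<open>distinct D\<close>
    by (intro inv_into_f_f) (auto simp: inj_on_def nth_eq_iff_index_eq)
  define P where "P z = column_matrix (D1 ! ind z) (D2 ! ind z)" for z
  have pot: "P b - P a = dir_matrix l" if "(a, l, b) \<in> dg_arcs ?G" for a l b
  proof -
    obtain i j where ij: "a = D ! i" "b = D ! j" "(i, l, j) \<in> index_arcs ls"
      using arcD[OF \<open>(a, l, b) \<in> dg_arcs ?G\<close>] by blast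
    then have "i < length D" "j < length D"
      using index_arcsD[OF ij(3) ls] len by auto
    then have P: "P b - P a = column_matrix (D1 ! j) (D2 ! j) - column_matrix (D1 ! i) (D2 ! i)"
      by (simp add: P_def ij ind)
    obtain k where k: "k < length ls" and c: "(i, l, j) = (k, ls ! k, Suc k mod length ls) \<or>
        (i, l, j) = (Suc k mod length ls, opposite (ls ! k), k)"
      using ij(3) by (auto simp: index_arcs_def Let_def)
    have "ls ! k \<in> {1..8}"
      using k ls by (metis nth_mem subsetD)
    with c show ?thesis
      using label_potential[OF D12 k, symmetric]
      by (auto simp: P dir_matrix_opposite simp del: atLeastAtMost_iff)
  qed
  show ?thesis
    unfolding direction_graph_def
  proof (intro conjI allI impI subsetI)
    fix t assume "t \<in> dg_arcs ?G"
    then obtain i l j where "t = (D ! i, l, D ! j)" "(i, l, j) \<in> index_arcs ls"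
      by (auto simp: arcs)
    then show "t \<in> dg_verts ?G \<times> {1..8} \<times> dg_verts ?G"
      using index_arcsD(1-3)[of i l j ls] ls len by (simp add: V)
  next
    fix a l b assume "(a, l, b) \<in> dg_arcs ?G"
    then obtain i j where "a = D ! i" "b = D ! j" "(i, l, j) \<in> index_arcs ls"
      using arcD by blast
    then show "\<exists>j. (b, j, a) \<in> dg_arcs ?G"
      using index_arcsD(4)[of i l j ls] ls by (force simp: arcs)
  next
    fix vs ls' assume "simple_dicycle ?G vs ls'"
    then show "sum_list (map dir_matrix ls') = 0"
      using dicycle_sum_potential[of ?G P] pot by blast
  qed
qed

lemma same_direction_graph_labeled:
  assumes "0 < r" "r < s" and D: "labeled_cycle r s D ls" and "distinct D"
    and "0 < r'" "r' < s'" and D': "labeled_cycle r' s' D' ls" and "distinct D'"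
  shows "same_direction_graph (extracted_graph r s D) (extracted_graph r' s' D')"
proof -
  have len: "length ls = length D" "length D' = length D" and ls: "set ls \<subseteq> {1..8}"
    using D D' by (auto simp: labeled_cycle_def)
  have bij: "bij_betw (nth D) {..<length D} (set D)" "bij_betw (nth D') {..<length D} (set D')"
    using bij_betw_nth[OF \<open>distinct D\<close>] bij_betw_nth[OF \<open>distinct D'\<close>] len by auto
  define ind where "ind = inv_into {..<length D} (nth D)"
  have ind: "ind (D ! i) = i" if "i < length D" for i
    unfolding ind_def using that bij_betw_imp_inj_on[OF bij(1)] by (intro inv_into_f_f) auto
  define f where "f z = D' ! ind z" for z
  have f: "f (D ! i) = D' ! i" if "i < length D" for i
    using that by (simp add: f_def ind)
  have arc: "((E ! i, l, E ! j) \<in> (\<lambda>(i, l, j). (E ! i, l, E ! j)) ` index_arcs ls) \<longleftrightarrow>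
      (i, l, j) \<in> index_arcs ls"
    if "distinct E" "length E = length D" "i < length D" "j < length D"
      for E :: "square list" and i l j
  proof
    assume "(E ! i, l, E ! j) \<in> (\<lambda>(i, l, j). (E ! i, l, E ! j)) ` index_arcs ls"
    then obtain i' j' where *: "E ! i = E ! i'" "E ! j = E ! j'" "(i', l, j') \<in> index_arcs ls"
      by auto
    then have "i' < length D" "j' < length D"
      using index_arcsD[OF *(3) ls] len by auto
    then have "i' = i" "j' = j"
      using * that by (metis nth_eq_iff_index_eq)+
    then show "(i, l, j) \<in> index_arcs ls"
      using * by simp
  qed force
  have "bij_betw f (set D) (set D')"
    using bij_betw_trans[OF bij_betw_inv_into[OF bij(1)] bij(2)]
    by (simp add: f_def[abs_def] ind_def comp_def)
  moreover have "\<forall>a\<in>set D. \<forall>b\<in>set D. \<forall>l. (a, l, b) \<in> dg_arcs (extracted_graph r s D) \<longleftrightarrow>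
      (f a, l, f b) \<in> dg_arcs (extracted_graph r' s' D')"
  proof (intro ballI allI)
    fix a b l assume "a \<in> set D" "b \<in> set D"
    then obtain i j where ij: "a = D ! i" "i < length D" "b = D ! j" "j < length D"
      by (auto simp: in_set_conv_nth)
    show "(a, l, b) \<in> dg_arcs (extracted_graph r s D) \<longleftrightarrow>
        (f a, l, f b) \<in> dg_arcs (extracted_graph r' s' D')"
      unfolding extracted_arcs[OF assms(1-3)] extracted_arcs[OF assms(5-7)]
        ij(1,3) f[OF ij(2)] f[OF ij(4)]
      by (rule trans[OF arc[OF assms(4) refl ij(2,4)] arc[OF assms(8) len(2) ij(2,4), symmetric]])
  qed
  ultimately show ?thesis
    unfolding same_direction_graph_def extracted_graph_def labeled_digraph.simps by blast
qed

section \<open>Liftings and the sections of a frame\<close>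

lemma mem_rot_image:
  "z \<in> rot ` S \<longleftrightarrow> (snd z, - fst z) \<in> S" "z \<in> (rot ^^ 2) ` S \<longleftrightarrow> - z \<in> S"
  "z \<in> (rot ^^ 3) ` S \<longleftrightarrow> rot z \<in> S"
proof -
  have "z = rot (snd z, - fst z)" "z = (rot ^^ 2) (- z)" "z = (rot ^^ 3) (rot z)"
    by (simp_all add: rot_def prod_eq_iff)
  then show "z \<in> rot ` S \<longleftrightarrow> (snd z, - fst z) \<in> S" "z \<in> (rot ^^ 2) ` S \<longleftrightarrow> - z \<in> S"
    "z \<in> (rot ^^ 3) ` S \<longleftrightarrow> rot z \<in> S"
    by (force simp: rot_def image_iff)+
qed

lemma rot_pair: "rot (x, y) = (- y, x)"
  by (simp add: rot_def)

lemma mem_frame_section: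
  "(x, y) \<in> frame_section m n 0 \<longleftrightarrow> n - m < 2 * x \<and> 2 * x < m + n \<and> 2 * \<bar>y\<bar> < n - m"
  "(x, y) \<in> frame_section m n (Suc 0) \<longleftrightarrow> n - m < 2 * x \<and> 2 * x < m + n \<and> n - m < 2 * y \<and> 2 * y < m + n"
  "(x, y) \<in> frame_section m n 2 \<longleftrightarrow> n - m < 2 * y \<and> 2 * y < m + n \<and> 2 * \<bar>x\<bar> < n - m"
  "(x, y) \<in> frame_section m n 3 \<longleftrightarrow> n - m < - 2 * x \<and> - 2 * x < m + n \<and> n - m < 2 * y \<and> 2 * y < m + n"
  "(x, y) \<in> frame_section m n 4 \<longleftrightarrow> n - m < - 2 * x \<and> - 2 * x < m + n \<and> 2 * \<bar>y\<bar> < n - m"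
  "(x, y) \<in> frame_section m n 5 \<longleftrightarrow> n - m < - 2 * x \<and> - 2 * x < m + n \<and> n - m < - 2 * y \<and> - 2 * y < m + n"
  "(x, y) \<in> frame_section m n 6 \<longleftrightarrow> n - m < - 2 * y \<and> - 2 * y < m + n \<and> 2 * \<bar>x\<bar> < n - m"
  "(x, y) \<in> frame_section m n 7 \<longleftrightarrow> n - m < 2 * x \<and> 2 * x < m + n \<and> n - m < - 2 * y \<and> - 2 * y < m + n"
  by (auto simp: frame_section_def mem_rot_image rot_pair simp del: rot_power)

lemma frame_section_disjoint:
  assumes "m < n" "z \<in> frame_section m n i" "z \<in> frame_section m n j" "i < 8" "j < 8"
  shows "i = j"
proof (cases z)
  case (Pair x y)
  show ?thesis
    using assms(4,5)
    by (elim less_8_cases) (use assms(1-3) in \<open>simp_all add: Pair mem_frame_section\<close>)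
qed

text \<open>The sections whose squares are translated into section \<open>i\<close> of the lifted frame.\<close>

fun lift_sources :: "lifting \<Rightarrow> nat \<Rightarrow> nat set" where
  "lift_sources Lf i = (if even i then {(i + 3) mod 8, (i + 4) mod 8, (i + 5) mod 8} else {i})"
| "lift_sources Lg i = (if even i then {i} else {(i + 3) mod 8, (i + 4) mod 8, (i + 5) mod 8})"
| "lift_sources Lh i =
     (if even i
      then {(i + 2) mod 8, (i + 3) mod 8, (i + 4) mod 8, (i + 5) mod 8, (i + 6) mod 8}
      else {(i + 7) mod 8, i, (i + 1) mod 8})"

lemma set_lift_path: "set (lift_path t a i) = (\<Union>j\<in>lift_sources t i. set (a j))"
  by (cases t) auto

text \<open>The geometric fact behind both the disjointness of the lifted paths and the agreement of the
  lifting of sets of squares with the lifting of split cycles.\<close>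

lemma translate_mem_frame_section:
  assumes "0 < m" "m < n" "z \<in> frame_section m n j" "i < 8" "j < 8"
  shows "z + lift_vec t (m, n) i \<in>
      frame_section (fst (lift_frame t (m, n))) (snd (lift_frame t (m, n))) i \<longleftrightarrow>
    j \<in> lift_sources t i"
proof (cases z)
  case (Pair x y)
  show ?thesis
  proof (cases t)
    case Lf
    show ?thesis using assms(4)
      by (elim less_8_cases; use assms(5) in \<open>elim less_8_cases\<close>)
        (use assms(1-3) Lf in \<open>auto simp: Pair mem_frame_section lift_vec_def\<close>)
  next
    case Lg
    show ?thesis using assms(4)
      by (elim less_8_cases; use assms(5) in \<open>elim less_8_cases\<close>)
        (use assms(1-3) Lg in \<open>auto simp: Pair mem_frame_section lift_vec_def\<close>)
  next
    case Lh
    show ?thesis using assms(4)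
      by (elim less_8_cases; use assms(5) in \<open>elim less_8_cases\<close>)
        (use assms(1-3) Lh in \<open>auto simp: Pair mem_frame_section lift_vec_def\<close>)
  qed
qed


lemma lift_frame_pos:
  assumes "0 < fst F" "fst F < snd F"
  shows "0 < fst (lift_frame t F)" "fst (lift_frame t F) < snd (lift_frame t F)"
  using assms by (cases F; cases t; simp)+

text \<open>Each path is simple and stays within its section of the frame \<open>F\<close>.\<close>

definition sectioned_split :: "int \<times> int \<Rightarrow> split_cycle \<Rightarrow> bool" where
  "sectioned_split F a \<longleftrightarrow>
     (\<forall>i<8. distinct (a i) \<and> set (a i) \<subseteq> frame_section (fst F) (snd F) i)"

lemma sectioned_split_disjoint:
  assumes "fst F < snd F" "sectioned_split F a" "i < 8" "j < 8" "i \<noteq> j"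
  shows "set (a i) \<inter> set (a j) = {}"
  using assms frame_section_disjoint[of "fst F" "snd F" _ i j]
  unfolding sectioned_split_def by blast

lemma distinct_sectioned_split:
  assumes "fst F < snd F" "sectioned_split F a"
  shows "distinct (concat (map a [0..<8]))"
proof -
  have "distinct (a i)" if "i < 8" for i
    using assms(2) that by (simp add: sectioned_split_def)
  then show ?thesis
    using sectioned_split_disjoint[OF assms] by (simp add: upt_0_8 Int_Un_distrib)
qed

lemma sectioned_split_lift:
  assumes F: "0 < fst F" "fst F < snd F" and a: "sectioned_split F a"
  shows "sectioned_split (lift_frame t F) (lift_split t F a)"
    and "lift_squares t F (\<Union>i<8. set (a i)) = (\<Union>i<8. set (lift_split t F a i))"
proof -
  obtain m n where mn: "F = (m, n)" by (cases F)
  have sec: "set (a i) \<subseteq> frame_section m n i" and dist: "distinct (a i)" if "i < 8" for i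
    using a that by (auto simp: sectioned_split_def mn)
  have src: "lift_sources t i \<subseteq> {..<8}" if "i < 8" for i
    using that by (cases t) auto
  let ?H = "frame_section (fst (lift_frame t F)) (snd (lift_frame t F))"
  have shift: "z + lift_vec t F i \<in> ?H i \<longleftrightarrow> j \<in> lift_sources t i"
    if "i < 8" "j < 8" "z \<in> set (a j)" for i j z
    using translate_mem_frame_section[of m n z j i t] F sec that by (auto simp: mn)
  have disj: "set (a i) \<inter> set (a j) = {}" if "i < 8" "j < 8" "i \<noteq> j" for i j
    using sectioned_split_disjoint[OF F(2) a that] .
  have "distinct (lift_path t a i)" if i: "i < 8" for i
    by (cases t; rule less_8_cases[OF i]) (simp_all add: dist disj Int_Un_distrib)
  then have "distinct (lift_split t F a i)" if "i < 8" for i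
    using that by (simp add: lift_split_def distinct_map inj_on_def)
  moreover have set: "set (lift_split t F a i) =
      (\<lambda>z. z + lift_vec t F i) ` (\<Union>j\<in>lift_sources t i. set (a j))" for i
    by (simp add: lift_split_def set_lift_path)
  moreover have "set (lift_split t F a i) \<subseteq> ?H i" if "i < 8" for i
    unfolding set using shift[OF that] src[OF that] by auto
  ultimately show "sectioned_split (lift_frame t F) (lift_split t F a)"
    by (simp add: sectioned_split_def)
  have "(\<lambda>z. z + lift_vec t F i) ` (\<Union>j<8. set (a j)) \<inter> ?H i = set (lift_split t F a i)"
    if "i < 8" for i
    unfolding set using shift[OF that] src[OF that] by fastforce
  then show "lift_squares t F (\<Union>i<8. set (a i)) = (\<Union>i<8. set (lift_split t F a i))"
    by (simp add: lift_squares_def cong: SUP_cong_simp)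
qed

lemma lift_frames_simps [simp]:
  "lift_frames [] F = F" "lift_frames (t # ts) F = lift_frame t (lift_frames ts F)"
  "lift_frames (ts @ us) F = lift_frames ts (lift_frames us F)"
  by (simp_all add: lift_frames_def)

lemma lift_frames_pos:
  assumes "0 < fst F" "fst F < snd F"
  shows "0 < fst (lift_frames es F)" "fst (lift_frames es F) < snd (lift_frames es F)"
proof (induction es)
  case Nil
  { case 1 show ?case using assms by simp
  next
    case 2 show ?case using assms by simp }
next
  case (Cons t es)
  { case 1 show ?case using lift_frame_pos[OF Cons.IH] by simp
  next
    case 2 show ?case using lift_frame_pos[OF Cons.IH] by simp }
qed

lemma sectioned_split_lift_list:
  assumes F: "0 < fst F" "fst F < snd F" and a: "sectioned_split F a"
  shows "sectioned_split (lift_frames es F) (lift_split_list es F a)"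
    and "lift_squares_list es F (\<Union>i<8. set (a i)) = (\<Union>i<8. set (lift_split_list es F a i))"
proof (induction es)
  case Nil
  { case 1 show ?case using a by simp
  next
    case 2 show ?case by simp }
next
  case (Cons t es)
  note step = sectioned_split_lift[OF lift_frames_pos[OF F, of es] Cons.IH(1), of t]
  { case 1 show ?case using step(1) by simp
  next
    case 2 show ?case using step(2) Cons.IH(2) by simp }
qed

section \<open>Number of squares of a lifted cycle\<close>

text \<open>The effect of a lifting on the common length \<open>u\<close> of the paths in even directions and the
  common length \<open>v\<close> of the paths in odd directions.\<close>

fun lift_lengths :: "lifting \<Rightarrow> nat \<times> nat \<Rightarrow> nat \<times> nat" where
  "lift_lengths Lf (u, v) = (u + 2 * v, v)"
| "lift_lengths Lg (u, v) = (u, 2 * u + v)"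
| "lift_lengths Lh (u, v) = (3 * u + 2 * v, 2 * u + v)"

lemma length_lift_split_list:
  assumes "\<And>i. i < 8 \<Longrightarrow> length (a i) = 1" "i < 8"
  shows "length (lift_split_list es F a i) =
    (if even i then fst else snd) (foldr lift_lengths es (1, 1))"
  using assms(2)
proof (induction es arbitrary: i)
  case Nil
  then show ?case using assms(1) by simp
next
  case (Cons t es)
  obtain u v where uv: "foldr lift_lengths es (1, 1) = (u, v)"
    by (cases "foldr lift_lengths es (1, 1)")
  have IH: "length (lift_split_list es F a j) = (if even j then u else v)" if "j < 8" for j
    using Cons.IH[OF that] uv by simp
  show ?case
    by (cases t; rule less_8_cases[OF Cons.prems]) (use uv in \<open>simp_all add: lift_split_def IH\<close>)
qed

text \<open>The number of squares of a cycle of descent \<open>es\<close>.\<close>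

definition cycle_size :: "lifting list \<Rightarrow> nat" where
  "cycle_size es = (case foldr lift_lengths es (1, 1) of (u, v) \<Rightarrow> 4 * (u + v))"

lemma card_lift_squares_list:
  assumes F: "0 < fst F" "fst F < snd F"
    and a: "\<And>i. i < 8 \<Longrightarrow> \<exists>z. a i = [z] \<and> z \<in> frame_section (fst F) (snd F) i"
  shows "card (lift_squares_list es F (\<Union>i<8. set (a i))) =
    cycle_size es"
proof -
  let ?b = "lift_split_list es F a"
  have a': "sectioned_split F a"
    unfolding sectioned_split_def using a by fastforce
  have len1: "length (a i) = 1" if "i < 8" for i
    using a[OF that] by auto
  have len: "length (?b i) = (if even i then fst else snd) (foldr lift_lengths es (1, 1))"
    if "i < 8" for i
    using length_lift_split_list[OF len1 that] .
  have "(\<Union>i<8. set (?b i)) = set (concat (map ?b [0..<8]))"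
    by auto
  moreover have "distinct (concat (map ?b [0..<8]))"
    using distinct_sectioned_split[OF lift_frames_pos(2)[OF F] sectioned_split_lift_list(1)[OF F a']] .
  ultimately have "card (\<Union>i<8. set (?b i)) = length (concat (map ?b [0..<8]))"
    by (simp only: distinct_card)
  also have "\<dots> = cycle_size es"
    by (simp add: upt_0_8 len cycle_size_def case_prod_beta)
  finally show ?thesis
    using sectioned_split_lift_list(2)[OF F a'] by simp
qed

lemma lift_lengths_list_strict_mono:
  assumes "u \<le> u'" "v \<le> v'" "u + v < u' + v'"
  shows "fst (foldr lift_lengths es (u, v)) \<le> fst (foldr lift_lengths es (u', v')) \<and>
    snd (foldr lift_lengths es (u, v)) \<le> snd (foldr lift_lengths es (u', v')) \<and>
    fst (foldr lift_lengths es (u, v)) + snd (foldr lift_lengths es (u, v)) <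
      fst (foldr lift_lengths es (u', v')) + snd (foldr lift_lengths es (u', v'))"
proof (induction es)
  case (Cons t es)
  then show ?case
    by (cases "foldr lift_lengths es (u, v)"; cases "foldr lift_lengths es (u', v')"; cases t) auto
qed (use assms in auto)

lemma lift_lengths_list_ge:
  "1 \<le> fst (foldr lift_lengths es (1, 1)) \<and> 1 \<le> snd (foldr lift_lengths es (1, 1))"
proof (induction es)
  case (Cons t es)
  then show ?case
    by (cases "foldr lift_lengths es (1, 1)"; cases t) auto
qed auto

text \<open>Together with \<open>card_lift_squares_list\<close>, this distinguishes the descents of cycles of one
  leaper, since these are prefixes of one string.\<close>

lemma lift_lengths_list_prefix:
  assumes "y \<noteq> []"
  shows "cycle_size e < cycle_size (e @ y)"
proof -
  obtain t y' where y: "y = t # y'"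
    using assms by (cases y) auto
  obtain u v where uv: "foldr lift_lengths y (1, 1) = (u, v)"
    by (cases "foldr lift_lengths y (1, 1)")
  obtain u' v' where uv': "foldr lift_lengths y' (1, 1) = (u', v')"
    by (cases "foldr lift_lengths y' (1, 1)")
  have "1 \<le> u" "1 \<le> v" "1 + 1 < u + v"
    using lift_lengths_list_ge[of y'] uv uv' by (cases t; auto simp: y)+
  then show ?thesis
    using lift_lengths_list_strict_mono[of 1 u 1 v e] uv
    by (simp add: cycle_size_def case_prod_beta)
qed

section \<open>Shell cycles\<close>

lemma shell_center:
  assumes "0 < m" "m < n" "z \<in> shell m n"
  shows "\<exists>i<8. \<exists>a b. z = subboard_center m n i + (a, b) \<and>
    2 * \<bar>a\<bar> < n - m \<and> 2 * \<bar>a\<bar> < 3 * m - n \<and> 2 * \<bar>b\<bar> < n - m \<and> 2 * \<bar>b\<bar> < 3 * m - n"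
proof -
  have less4: "k = 0 \<or> k = 1 \<or> k = 2 \<or> k = 3" if "k < 4" for k :: nat
    using that by auto
  let ?S = "if n \<le> 2 * m then
        {(x, y). 3 * m - n < 2 * x \<and> 2 * x < m + n \<and> 3 * m - n < 2 * y \<and> 2 * y < m + n} \<union>
        {(x, y). n - m < 2 * x \<and> 2 * x < 3 * (n - m) \<and> 2 * \<bar>y\<bar> < n - m}
      else if n \<le> 3 * m then
        {(x, y). 3 * n - 5 * m < 2 * x \<and> 2 * x < m + n \<and> 2 * \<bar>y\<bar> < 3 * m - n} \<union>
        {(x, y). n - m < 2 * x \<and> 2 * x < 5 * m - n \<and> n - m < 2 * y \<and> 2 * y < 5 * m - n}
      else {}"
  obtain k u v where k: "k < 4" and zk: "z = (rot ^^ k) (u, v)" and uv: "(u, v) \<in> ?S"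
    using assms(3) unfolding shell_def by auto
  define Q where "Q a b \<longleftrightarrow> 2 * \<bar>a\<bar> < n - m \<and> 2 * \<bar>a\<bar> < 3 * m - n \<and>
    2 * \<bar>b\<bar> < n - m \<and> 2 * \<bar>b\<bar> < 3 * m - n" for a b :: int
  have "(\<exists>a b. (u, v) = (m + a, m + b) \<and> Q a b) \<or> (\<exists>a b. (u, v) = (n - m + a, b) \<and> Q a b)"
  proof -
    have "Q (u - m) (v - m) \<or> Q (u - (n - m)) v"
    proof -
      consider "n \<le> 2 * m" "3 * m - n < 2 * u" "2 * u < m + n" "3 * m - n < 2 * v" "2 * v < m + n"
        | "n \<le> 2 * m" "n - m < 2 * u" "2 * u < 3 * (n - m)" "2 * \<bar>v\<bar> < n - m"
        | "2 * m < n" "3 * n - 5 * m < 2 * u" "2 * u < m + n" "2 * \<bar>v\<bar> < 3 * m - n"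
        | "2 * m < n" "n - m < 2 * u" "2 * u < 5 * m - n" "n - m < 2 * v" "2 * v < 5 * m - n"
        using uv by (auto split: if_splits)
      then show ?thesis
      proof cases
        case 1
        then have "Q (u - m) (v - m)" unfolding Q_def by (intro conjI; arith)
        then show ?thesis ..
      next
        case 2
        then have "Q (u - (n - m)) v" unfolding Q_def by (intro conjI; arith)
        then show ?thesis ..
      next
        case 3
        then have "Q (u - (n - m)) v" unfolding Q_def by (intro conjI; arith)
        then show ?thesis ..
      next
        case 4
        then have "Q (u - m) (v - m)" unfolding Q_def by (intro conjI; arith)
        then show ?thesis ..
      qed
    qed
    then show ?thesis
      by (metis add_diff_cancel_left' add.commute diff_add_cancel)
  qed
  then obtain j a b where j: "j < 2" "(u, v) = subboard_center m n j + (a, b)" and Q: "Q a b"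
    by (elim disjE exE conjE) (force simp: subboard_center_def intro: that[of 1] that[of 0])+
  have "z = subboard_center m n (j + 2 * k) + (rot ^^ k) (a, b)"
    using less4[OF k] j less_2_cases[OF j(1)]
    by (auto simp: zk subboard_center_def rot_def simp flip: numeral_2_eq_2 numeral_3_eq_3)
  moreover have "Q (fst ((rot ^^ k) (a, b))) (snd ((rot ^^ k) (a, b)))"
    using less4[OF k] Q by (auto simp: rot_def Q_def)
  moreover have "j + 2 * k < 8"
    using j k by simp
  ultimately show ?thesis
    unfolding Q_def by (metis prod.collapse)
qed

lemma center_mem_frame_section:
  assumes "2 * \<bar>a\<bar> < n - m" "2 * \<bar>a\<bar> < 3 * m - n" "2 * \<bar>b\<bar> < n - m" "2 * \<bar>b\<bar> < 3 * m - n" "i < 8"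
  shows "subboard_center m n i + (a, b) \<in> frame_section m n i"
  by (rule less_8_cases[OF assms(5)])
    (use assms(1-4) in \<open>auto simp: subboard_center_def mem_frame_section\<close>)

text \<open>The offset from the subboard center is unchanged by a move between squares of the shell. Each
  center coordinate is one of \<open>0\<close>, \<open>\<plusminus> m\<close>, \<open>\<plusminus> (n - m)\<close>, and a change of offset by less than \<open>m\<close> and
  \<open>n - m\<close> cannot compensate for a wrong difference of centers.\<close>

lemma center_move:
  assumes "0 < m" "m < n" "i < 8" "j < 8"
    and ab: "a < m" "- m < a" "a < n - m" "m - n < a" "b < m" "- m < b" "b < n - m" "m - n < b"
    and "subboard_center m n j - subboard_center m n i + (a, b) \<in> leaper_moves m n"
  shows "a = 0 \<and> b = 0"
  using assms(3)
  by (elim less_8_cases; use assms(4) in \<open>elim less_8_cases\<close>)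
    (use assms(1,2) ab assms(13) in \<open>auto simp: subboard_center_def leaper_moves_def\<close>)

lemma shell_cycle_centers:
  assumes "0 < m" "m < n" and C: "shell_cycle m n C"
  obtains v where "set C = (\<lambda>i. subboard_center m n i + v) ` {..<8}"
    and "\<And>i. i < 8 \<Longrightarrow> subboard_center m n i + v \<in> frame_section m n i"
proof -
  define Q where "Q a b \<longleftrightarrow> 2 * \<bar>a\<bar> < n - m \<and> 2 * \<bar>a\<bar> < 3 * m - n \<and>
    2 * \<bar>b\<bar> < n - m \<and> 2 * \<bar>b\<bar> < 3 * m - n" for a b :: int
  have len: "length C = 8" and dist: "distinct C" and sub: "set C \<subseteq> shell m n"
    and mv: "\<And>k. k < 8 \<Longrightarrow> C ! (Suc k mod 8) - C ! k \<in> leaper_moves m n"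
    using C by (auto simp: shell_cycle_def leaper_cycle_def)
  have cen: "\<exists>i<8. \<exists>a b. C ! k = subboard_center m n i + (a, b) \<and> Q a b" if "k < 8" for k
  proof -
    have "C ! k \<in> shell m n"
      using sub len that by (metis nth_mem subsetD)
    then show ?thesis
      using shell_center[OF assms(1,2)] unfolding Q_def by blast
  qed
  obtain i0 a b where i0: "i0 < 8" "C ! 0 = subboard_center m n i0 + (a, b)" and Q: "Q a b"
    using cen[of 0] by auto
  have all: "\<exists>i<8. C ! k = subboard_center m n i + (a, b)" if "k < 8" for k
    using that
  proof (induction k)
    case 0
    then show ?case using i0 by blast
  next
    case (Suc k)
    then obtain i where i: "i < 8" "C ! k = subboard_center m n i + (a, b)"
      by auto
    obtain j c d where j: "j < 8" "C ! Suc k = subboard_center m n j + (c, d)" and Q': "Q c d"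
      using cen[OF Suc.prems] by auto
    have "C ! Suc k - C ! k \<in> leaper_moves m n"
      using mv[of k] Suc.prems by simp
    moreover have "C ! Suc k - C ! k = subboard_center m n j - subboard_center m n i + (c - a, d - b)"
      unfolding i(2) j(2) by (simp add: algebra_simps)
    ultimately have "c - a = 0 \<and> d - b = 0"
      \<comment> \<open>The average of \<open>n - m\<close> and \<open>3 * m - n\<close> is \<open>m\<close>, so the offsets differ by less than \<open>m\<close>.\<close>
      using Q Q' unfolding Q_def by (intro center_move[OF assms(1,2) i(1) j(1)]) auto
    then show ?case
      using j by auto
  qed
  have "set C \<subseteq> (\<lambda>i. subboard_center m n i + (a, b)) ` {..<8}"
  proof
    fix z assume "z \<in> set C"
    then obtain k where "k < 8" "z = C ! k"
      using len by (metis in_set_conv_nth)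
    then show "z \<in> (\<lambda>i. subboard_center m n i + (a, b)) ` {..<8}"
      using all[of k] by blast
  qed
  moreover have "card (set C) = 8"
    using len dist by (simp add: distinct_card)
  moreover have "card ((\<lambda>i. subboard_center m n i + (a, b)) ` {..<8::nat}) \<le> 8"
    using card_image_le[of "{..<8::nat}" "\<lambda>i. subboard_center m n i + (a, b)"] by simp
  ultimately have "set C = (\<lambda>i. subboard_center m n i + (a, b)) ` {..<8}"
    by (intro card_seteq) auto
  then show thesis
    using that center_mem_frame_section Q unfolding Q_def by blast
qed

section \<open>Uniqueness of descents\<close>

lemma start_frame_pos:
  "0 < fst (lift_frames d (1, 2))"
  "fst (lift_frames d (1, 2)) < snd (lift_frames d (1, 2))"
  using lift_frames_pos[of "(1, 2)" d] by simp_all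

lemma card_cycle_from_shell:
  assumes "cycle_from_shell p q C e d C'"
  shows "card (set C) = cycle_size e"
proof -
  obtain m n where mn: "lift_frames d (1, 2) = (m, n)"
    by fastforce
  have pos: "0 < m" "m < n"
    using start_frame_pos[of d] by (simp_all add: mn)
  have "shell_cycle m n C'" and C: "set C = lift_squares_list e (m, n) (set C')"
    using assms by (auto simp: cycle_from_shell_def mn)
  then obtain v where v: "set C' = (\<lambda>i. subboard_center m n i + v) ` {..<8}"
    "\<And>i. i < 8 \<Longrightarrow> subboard_center m n i + v \<in> frame_section m n i"
    using shell_cycle_centers[OF pos] by blast
  have "set C' = (\<Union>i<8. set [subboard_center m n i + v])"
    unfolding v(1) by auto
  then show ?thesis
    unfolding C using card_lift_squares_list[of "(m, n)" "\<lambda>i. [subboard_center m n i + v]" e] pos v(2)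
    by simp
qed

text \<open>The liftings \<open>Lf\<close>, \<open>Lg\<close>, \<open>Lh\<close> lead to frames with \<open>n > 3 * m\<close>, \<open>n < 2 * m\<close> and
  \<open>2 * m < n < 3 * m\<close>, respectively. The start frame has \<open>n = 2 * m\<close>.\<close>

lemma lift_frame_inject:
  assumes "0 < fst F" "fst F < snd F" "0 < fst G" "fst G < snd G"
    and "lift_frame t F = lift_frame u G"
  shows "t = u \<and> F = G"
  using assms by (cases F; cases G; cases t; cases u; simp)

lemma lift_frame_neq_start:
  assumes "0 < fst F" "fst F < snd F"
  shows "lift_frame t F \<noteq> (1, 2)"
  using assms by (cases F; cases t) auto

lemma leaper_descent_unique:
  assumes "lift_frames es (1, 2) = lift_frames es' (1, 2)"
  shows "es = es'"
  using assms
proof (induction es arbitrary: es')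
  case Nil
  then show ?case
    using lift_frame_neq_start[OF start_frame_pos] by (metis lift_frames_simps(1,2) neq_Nil_conv)
next
  case (Cons t es)
  show ?case
  proof (cases es')
    case Nil
    then show ?thesis
      using Cons.prems lift_frame_neq_start[OF start_frame_pos] by simp
  next
    case (Cons u us)
    then have "lift_frame t (lift_frames es (1, 2)) = lift_frame u (lift_frames us (1, 2))"
      using Cons.prems by simp
    then have "t = u \<and> lift_frames es (1, 2) = lift_frames us (1, 2)"
      by (intro lift_frame_inject start_frame_pos)
    then show ?thesis
      using Cons.IH Cons by blast
  qed
qed

lemma cycle_descent_unique:
  assumes "cycle_from_shell p q C e d C'" "cycle_from_shell p q C e' d' C''"
  shows "e = e'"
proof -
  have "e @ d = e' @ d'"
    using assms by (intro leaper_descent_unique) (simp add: cycle_from_shell_def leaper_descent_def)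
  then obtain y where "e = e' @ y \<or> e' = e @ y"
    by (auto simp: append_eq_append_conv2)
  moreover have "cycle_size e =
      cycle_size e'"
    using card_cycle_from_shell[OF assms(1)] card_cycle_from_shell[OF assms(2)] by (rule trans[OF sym])
  ultimately show ?thesis
    using lift_lengths_list_prefix[of y e] lift_lengths_list_prefix[of y e'] by (cases "y = []") auto
qed

section \<open>Second leaper cycles with skew second leaper\<close>

lemma skew_second_cycle_labeled:
  assumes "skew_second_cycle p q C r s D e x"
  shows "0 < r" "r < s" "x \<noteq> Lf"
    "labeled_cycle r s D (descent_labels e x)" "distinct D" "3 \<le> length D"
proof -
  obtain d where "d \<noteq> []" "x = hd d" and can: "canonical_second_cycle p q C e d r s D"
    using assms by (auto simp: skew_second_cycle_def)
  then obtain d' where d: "d = x # d'"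
    by (cases d) auto
  have rs: "(r, s) = lift_frames d' (1, 2)"
    using can by (simp add: canonical_second_cycle_def d)
  then show "0 < r" "r < s"
    using start_frame_pos[of d'] by (metis fst_conv snd_conv)+
  obtain m n where mn: "lift_frames d (1, 2) = (m, n)"
    by fastforce
  then have lift: "lift_frame x (r, s) = (m, n)"
    by (simp add: d flip: rs)
  have pos: "0 < m" "m < n"
    using start_frame_pos[of d] by (simp_all add: mn)
  obtain C' a where sh: "shell_cycle m n C'"
    and a: "\<And>i. i < 8 \<Longrightarrow> \<exists>z \<in> set C' \<inter> frame_section m n i. a i = [z]"
    and D: "D = concat (map (lift_split_list e (m, n) a) [0..<8])"
    using can by (auto simp: canonical_second_cycle_def cycle_from_shell_def mn)
  show x: "x \<noteq> Lf"
  proof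
    assume "x = Lf"
    \<comment> \<open>Then \<open>n = 2 * r + s > 3 * m\<close>, and there is no shell.\<close>
    then have "shell m n = {}"
      using lift \<open>0 < r\<close> \<open>r < s\<close> by (auto simp: shell_def)
    then show False
      using sh by (auto simp: shell_cycle_def leaper_cycle_def)
  qed
  obtain v where v: "set C' = (\<lambda>i. subboard_center m n i + v) ` {..<8}"
    "\<And>i. i < 8 \<Longrightarrow> subboard_center m n i + v \<in> frame_section m n i"
    using shell_cycle_centers[OF pos sh] by blast
  have a_eq: "a i = [subboard_center m n i + v]" if i: "i < 8" for i
  proof -
    obtain z where z: "z \<in> set C'" "z \<in> frame_section m n i" "a i = [z]"
      using a[OF i] by blast
    then obtain j where j: "j < 8" "z = subboard_center m n j + v"
      using v(1) by auto
    then have "i = j"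
      using frame_section_disjoint[OF pos(2) z(2) _ i j(1)] v(2) by simp
    then show ?thesis
      using z(3) j by simp
  qed
  show lab: "labeled_cycle r s D (descent_labels e x)"
    unfolding D using labeled_cycle_descent[OF x lift a_eq] by simp
  have "sectioned_split (m, n) a"
    using v(2) by (simp add: sectioned_split_def a_eq)
  then have sec: "sectioned_split (lift_frames e (m, n)) (lift_split_list e (m, n) a)"
    using pos by (intro sectioned_split_lift_list(1)) auto
  have "fst (lift_frames e (m, n)) < snd (lift_frames e (m, n))"
    using pos by (intro lift_frames_pos) auto
  then show "distinct D"
    unfolding D using sec by (rule distinct_sectioned_split)
  have "length (descent_labels e x) = length D"
    using lab by (simp add: labeled_cycle_def)
  then show "3 \<le> length D"
    by (simp add: descent_labels_def cycle_labels_def upt_0_8)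
qed

lemma same_direction_graph_descent:
  assumes "skew_second_cycle p q C r s D e x" "skew_second_cycle p' q' C' r' s' D' e x"
  shows "same_direction_graph (extracted_graph r s D) (extracted_graph r' s' D')"
  using same_direction_graph_labeled[OF skew_second_cycle_labeled(1,2,4,5)[OF assms(1)]
      skew_second_cycle_labeled(1,2,4,5)[OF assms(2)]] .

lemma potential_cycles:
  assumes "x \<noteq> Lf"
  obtains D1 D2 where "labeled_cycle 1 0 D1 (descent_labels e x)"
    "labeled_cycle 0 1 D2 (descent_labels e x)"
proof -
  have "\<exists>D. labeled_cycle r s D (descent_labels e x)" for r s
  proof -
    obtain m n where "lift_frame x (r, s) = (m, n)"
      by fastforce
    from labeled_cycle_descent[OF assms this, of "\<lambda>i. [subboard_center m n i + 0]" 0 e] show ?thesis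
      by auto
  qed
  then show thesis
    using that by blast
qed

section \<open>Even continued fractions\<close>

text \<open>Coefficients and signs of an even continued fraction, whatever its value. The first
  coefficient may be zero.\<close>

definition even_cf_expansion :: "nat list \<Rightarrow> int list \<Rightarrow> bool" where
  "even_cf_expansion cs \<sigma>s \<longleftrightarrow> length cs = Suc (length \<sigma>s) \<and> (\<forall>c \<in> set cs. even c) \<and>
     (\<forall>c \<in> set (tl cs). 0 < c) \<and> set \<sigma>s \<subseteq> {1, - 1}"

lemma even_cf_expansion_Cons:
  assumes "even_cf_expansion (c # cs) \<sigma>s"
  obtains "cs = []" "\<sigma>s = []" "cf_value (c # cs) \<sigma>s = of_nat c"
  | \<sigma> \<tau>s where "cs \<noteq> []" "\<sigma>s = \<sigma> # \<tau>s" "\<sigma> = 1 \<or> \<sigma> = - 1" "even_cf_expansion cs \<tau>s" "0 < hd cs"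
      "cf_value (c # cs) \<sigma>s = of_nat c + of_int \<sigma> / cf_value cs \<tau>s"
proof (cases cs)
  case Nil
  then show thesis
    using assms that(1) by (simp add: even_cf_expansion_def)
next
  case (Cons c' cs')
  then obtain \<sigma> \<tau>s where s: "\<sigma>s = \<sigma> # \<tau>s"
    using assms by (cases \<sigma>s) (auto simp: even_cf_expansion_def)
  show thesis
    by (rule that(2)[of \<sigma> \<tau>s]) (use assms Cons s in \<open>auto simp: even_cf_expansion_def\<close>)
qed

lemma cf_value_gt_1:
  assumes "even_cf_expansion cs \<sigma>s" "0 < hd cs"
  shows "1 < cf_value cs \<sigma>s"
  using assms
proof (induction cs arbitrary: \<sigma>s)
  case Nil
  then show ?case by (simp add: even_cf_expansion_def)
next
  case (Cons c cs)
  have "2 \<le> c"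
    using Cons.prems by (auto simp: even_cf_expansion_def elim: evenE)
  then have c: "(2 :: rat) \<le> of_nat c"
    by (metis of_nat_le_iff of_nat_numeral)
  show ?case
    using Cons.prems(1)
  proof (cases rule: even_cf_expansion_Cons)
    case 1
    then show ?thesis using c by simp
  next
    case (2 \<sigma> \<tau>s)
    then have "1 < cf_value cs \<tau>s"
      using Cons.IH by blast
    then have "- 1 < of_int \<sigma> / cf_value cs \<tau>s"
      using 2(3) by (auto simp: field_simps)
    then show ?thesis using c 2 by simp
  qed
qed

lemma cf_value_fractional_part:
  assumes "even_cf_expansion (c # cs) \<sigma>s"
  shows "\<bar>cf_value (c # cs) \<sigma>s - of_nat c\<bar> < 1"
  using assms
proof (cases rule: even_cf_expansion_Cons)
  case (2 \<sigma> \<tau>s)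
  then have "1 < cf_value cs \<tau>s"
    by (intro cf_value_gt_1)
  then have "\<bar>of_int \<sigma> / cf_value cs \<tau>s\<bar> < 1"
    using 2(3) by auto
  then show ?thesis
    unfolding 2(6) by simp
qed simp

text \<open>Two values that agree have first coefficients at distance less than 2 by
  \<open>cf_value_fractional_part\<close>; being even, the coefficients are equal.\<close>

lemma even_cf_expansion_unique:
  assumes "even_cf_expansion cs \<sigma>s" "even_cf_expansion cs' \<sigma>s'"
    and "cf_value cs \<sigma>s = cf_value cs' \<sigma>s'"
  shows "cs = cs' \<and> \<sigma>s = \<sigma>s'"
  using assms
proof (induction cs arbitrary: \<sigma>s cs' \<sigma>s')
  case Nil
  then show ?case by (simp add: even_cf_expansion_def)
next
  case (Cons c cs)
  obtain c' ds where cs': "cs' = c' # ds"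
    using Cons.prems(2) by (cases cs') (auto simp: even_cf_expansion_def)
  have "\<bar>(of_nat c :: rat) - of_nat c'\<bar> < 2"
    using cf_value_fractional_part[OF Cons.prems(1)]
      cf_value_fractional_part[OF Cons.prems(2)[unfolded cs']] Cons.prems(3)[unfolded cs']
    by linarith
  then have "of_int \<bar>int c - int c'\<bar> < (of_int 2 :: rat)"
    by simp
  then have "\<bar>int c - int c'\<bar> < 2"
    by (simp only: of_int_less_iff)
  moreover have "even c" "even c'"
    using Cons.prems(1,2) by (auto simp: even_cf_expansion_def cs')
  ultimately have c: "c' = c"
    by presburger
  show ?case
    using Cons.prems(1)
  proof (cases rule: even_cf_expansion_Cons)
    case 1
    show ?thesis
      using Cons.prems(2)[unfolded cs']
    proof (cases rule: even_cf_expansion_Cons)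
      case 1
      then show ?thesis using \<open>cs = []\<close> \<open>\<sigma>s = []\<close> cs' c by simp
    next
      case (2 \<sigma> \<tau>s)
      then have "1 < cf_value ds \<tau>s"
        by (intro cf_value_gt_1)
      then show ?thesis
        using 2 1 Cons.prems(3) cs' c by auto
    qed
  next
    case o: (2 \<sigma> \<tau>s)
    then have v: "1 < cf_value cs \<tau>s"
      by (intro cf_value_gt_1)
    show ?thesis
      using Cons.prems(2)[unfolded cs']
    proof (cases rule: even_cf_expansion_Cons)
      case 1
      then show ?thesis
        using o v Cons.prems(3) cs' c by auto
    next
      case (2 \<sigma>' \<tau>s')
      then have v': "1 < cf_value ds \<tau>s'"
        by (intro cf_value_gt_1)
      have eq: "of_int \<sigma> / cf_value cs \<tau>s = of_int \<sigma>' / cf_value ds \<tau>s'"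
        using Cons.prems(3) o 2 cs' c by simp
      have "\<sigma> = \<sigma>'"
      proof (rule ccontr)
        assume "\<sigma> \<noteq> \<sigma>'"
        then have "cf_value cs \<tau>s = - cf_value ds \<tau>s'"
          using eq o(3) 2(3) v v' by (auto simp: field_simps)
        then show False
          using v v' by simp
      qed
      moreover have "cf_value cs \<tau>s = cf_value ds \<tau>s'"
        using eq o(3) v v' unfolding \<open>\<sigma> = \<sigma>'\<close>[symmetric] by (auto simp: field_simps)
      ultimately show ?thesis
        using Cons.IH[OF o(4) 2(4)] o(2) 2(2) cs' c by simp
    qed
  qed
qed

lemma lift_frames_replicate_Lf:
  "lift_frames (replicate k Lf) (m, n) = (m, n + 2 * int k * m)"
  by (induction k) (simp_all add: algebra_simps)

text \<open>The ratio \<open>n / m\<close> is mapped to \<open>n / m + 2\<close> by \<open>Lf\<close>, to \<open>2 - m / n\<close> by \<open>Lg\<close> and to \<open>2 + m / n\<close>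
  by \<open>Lh\<close>.\<close>

lemma lift_frames_cf_string:
  assumes "even_cf_expansion cs \<sigma>s" "0 < hd cs" "lift_frames (cf_string cs \<sigma>s) (1, 2) = (m, n)"
  shows "of_int n = cf_value cs \<sigma>s * of_int m"
  using assms
proof (induction cs arbitrary: \<sigma>s m n)
  case Nil
  then show ?case by (simp add: even_cf_expansion_def)
next
  case (Cons c cs)
  have "even c" "0 < c"
    using Cons.prems(1,2) by (auto simp: even_cf_expansion_def)
  then obtain b where b: "c = 2 * b" "0 < b"
    by auto
  then obtain k where k: "c = 2 * Suc k"
    by (cases b) auto
  then have ck: "c div 2 - 1 = k"
    by simp
  show ?case
    using Cons.prems(1)
  proof (cases rule: even_cf_expansion_Cons)
    case 1
    then show ?thesis
      using Cons.prems(3) ck by (auto simp: lift_frames_replicate_Lf k)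
  next
    case (2 \<sigma> \<tau>s)
    let ?t = "if \<sigma> = - 1 then Lg else Lh"
    obtain c' cs' where cs: "cs = c' # cs'"
      using 2(1) by (cases cs) auto
    obtain m' n' where mn': "lift_frames (cf_string cs \<tau>s) (1, 2) = (m', n')"
      by fastforce
    have pos: "0 < m'" "m' < n'"
      using start_frame_pos[of "cf_string cs \<tau>s"] by (simp_all add: mn')
    have v: "1 < cf_value cs \<tau>s"
      using 2(4,5) by (rule cf_value_gt_1)
    have IH: "of_int n' = cf_value cs \<tau>s * of_int m'"
      using Cons.IH[OF 2(4,5) mn'] .
    have "cf_string (c # cs) \<sigma>s = replicate k Lf @ ?t # cf_string cs \<tau>s"
      using 2(2) cs ck by simp
    then have mn: "(m, n) = lift_frames (replicate k Lf) (lift_frame ?t (m', n'))"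
      using Cons.prems(3) mn' by simp
    have "m = n'" "n = 2 * n' + \<sigma> * m' + 2 * int k * n'"
      using mn 2(3) by (auto simp: lift_frames_replicate_Lf)
    moreover have "cf_value (c # cs) \<sigma>s * of_int n' = of_nat c * of_int n' + of_int \<sigma> * of_int m'"
      using v by (simp add: 2(6) IH field_simps)
    ultimately show ?thesis
      by (simp add: k algebra_simps)
  qed
qed

lemma coprime_lift_frames:
  assumes "coprime (fst F) (snd F)"
  shows "coprime (fst (lift_frames es F)) (snd (lift_frames es F))"
proof (induction es)
  case (Cons t es)
  obtain m n where mn: "lift_frames es F = (m, n)" by fastforce
  have *: "coprime m n"
    using Cons by (simp add: mn)
  have "gcd m (2 * m + n) = gcd m n" "gcd n (2 * n - m) = gcd m n" "gcd n (m + 2 * n) = gcd m n"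
    using gcd_add_mult[of m 2 n] gcd_add_mult[of n 2 "- m"] gcd_add_mult[of n 2 m]
    by (simp_all add: gcd.commute algebra_simps)
  then show ?case
    using * by (cases t) (simp_all add: mn coprime_iff_gcd_eq_1)
qed (use assms in simp)

lemma leaper_descent_cf_string:
  assumes "0 < p" "p < q" "coprime p q" "even_cf p q cs \<sigma>s"
  shows "lift_frames (cf_string cs \<sigma>s) (1, 2) = (p, q)"
proof -
  have E: "even_cf_expansion cs \<sigma>s" and v: "cf_value cs \<sigma>s = of_int q / of_int p"
    using assms(4) by (auto simp: even_cf_def even_cf_expansion_def)
  have "1 < cf_value cs \<sigma>s"
    unfolding v using assms(1,2) by simp
  have "0 < hd cs"
  proof (cases cs)
    case Nil
    then show ?thesis using E by (simp add: even_cf_expansion_def)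
  next
    case (Cons c cs')
    show ?thesis
      using cf_value_fractional_part[of c cs' \<sigma>s] E \<open>1 < cf_value cs \<sigma>s\<close>
      by (auto simp: Cons intro: gr0I)
  qed
  obtain m n where mn: "lift_frames (cf_string cs \<sigma>s) (1, 2) = (m, n)" by fastforce
  have pos: "0 < m" "m < n"
    using start_frame_pos[of "cf_string cs \<sigma>s"] by (simp_all add: mn)
  have cop: "coprime m n"
    using coprime_lift_frames[of "(1, 2)" "cf_string cs \<sigma>s"] by (simp add: mn)
  have "(of_int n :: rat) = of_int q / of_int p * of_int m"
    using lift_frames_cf_string[OF E \<open>0 < hd cs\<close> mn] v by simp
  then have "of_int (n * p) = (of_int (q * m) :: rat)"
    using assms(1) by (simp add: field_simps)
  then have eq: "n * p = q * m"
    by (simp only: of_int_eq_iff)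
  then have "m dvd p" "p dvd m"
    using cop assms(3)
    by (metis coprime_dvd_mult_right_iff dvd_triv_right, metis coprime_dvd_mult_right_iff dvd_triv_right)
  then have "m = p"
    using pos(1) assms(1) by (simp add: zdvd_antisym_nonneg)
  then show ?thesis
    using eq assms(1) by (simp add: mn)
qed

section \<open>Types of cycles and the main result\<close>

lemma cf_string_split:
  assumes "1 \<le> k" "k < length cs" "length cs = Suc (length \<sigma>s)"
  shows "cf_string cs \<sigma>s = cf_string (take k cs) (take (k - 1) \<sigma>s) @
    (if \<sigma>s ! (k - 1) = - 1 then Lg else Lh) # cf_string (drop k cs) (drop k \<sigma>s)"
  using assms
proof (induction k arbitrary: cs \<sigma>s)
  case (Suc k)
  obtain c c' cs' \<sigma> \<tau>s where cs: "cs = c # c' # cs'" "\<sigma>s = \<sigma> # \<tau>s"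
    using Suc.prems by (cases cs; cases "tl cs"; cases \<sigma>s) auto
  show ?case
  proof (cases k)
    case 0
    then show ?thesis by (simp add: cs)
  next
    case (Suc k')
    have "cf_string (c' # cs') \<tau>s = cf_string (take k (c' # cs')) (take (k - 1) \<tau>s) @
        (if \<tau>s ! (k - 1) = - 1 then Lg else Lh) # cf_string (drop k (c' # cs')) (drop k \<tau>s)"
      using Suc.prems by (intro Suc.IH) (auto simp: cs Suc)
    then show ?thesis
      by (simp add: cs Suc)
  qed
qed simp

lemma skew_second_cycle_type:
  assumes D: "skew_second_cycle p q C r s D e x" and "cycle_type p q C k" and cf: "even_cf p q cs \<sigma>s"
  shows "1 \<le> k" "k < length cs" "e = cf_string (take k cs) (take (k - 1) \<sigma>s)"
    "x = (if \<sigma>s ! (k - 1) = - 1 then Lg else Lh)"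
proof -
  have pq: "0 < p" "p < q" "coprime p q"
    using D by (auto simp: skew_second_cycle_def basic_def coprime_iff_gcd_eq_1)
  obtain d C' where d: "d \<noteq> []" "x = hd d" and from_shell: "cycle_from_shell p q C e d C'"
    using D by (auto simp: skew_second_cycle_def canonical_second_cycle_def)
  obtain cs' \<sigma>s' where cf': "even_cf p q cs' \<sigma>s'" and k: "1 \<le> k" "k \<le> length cs'"
    and desc: "cycle_descent p q C (cf_string (take k cs') (take (k - 1) \<sigma>s'))"
    using assms(2) by (auto simp: cycle_type_def)
  have "cs' = cs \<and> \<sigma>s' = \<sigma>s"
    using cf cf' by (intro even_cf_expansion_unique) (auto simp: even_cf_def even_cf_expansion_def)
  then have k': "k \<le> length cs"
    and desc': "cycle_descent p q C (cf_string (take k cs) (take (k - 1) \<sigma>s))"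
    using k desc by auto
  show e: "e = cf_string (take k cs) (take (k - 1) \<sigma>s)"
    using desc' cycle_descent_unique[OF from_shell] unfolding cycle_descent_def by blast
  have len: "length cs = Suc (length \<sigma>s)"
    using cf by (simp add: even_cf_def)
  have "lift_frames (e @ d) (1, 2) = (p, q)"
    using from_shell by (simp add: cycle_from_shell_def leaper_descent_def)
  then have ed: "e @ d = cf_string cs \<sigma>s"
    using leaper_descent_cf_string[OF pq cf] by (intro leaper_descent_unique) simp
  show "1 \<le> k"
    by (fact k(1))
  show "k < length cs"
  proof (rule ccontr)
    assume "\<not> k < length cs"
    then have "e = cf_string cs \<sigma>s"
      using e k' len by simp
    then show False
      using ed d(1) by simp
  qed
  then have "d = (if \<sigma>s ! (k - 1) = - 1 then Lg else Lh) # cf_string (drop k cs) (drop k \<sigma>s)"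
    using ed cf_string_split[OF k(1) _ len] e by simp
  then show "x = (if \<sigma>s ! (k - 1) = - 1 then Lg else Lh)"
    using d(2) by simp
qed

lemma cf_convergent_determines:
  assumes "even_cf p q cs \<sigma>s" "1 \<le> k" "k < length cs"
    and "even_cf p' q' cs' \<sigma>s'" "1 \<le> k'" "k' < length cs'"
    and "cf_convergent k cs \<sigma>s = cf_convergent k' cs' \<sigma>s'"
  shows "take k cs = take k' cs' \<and> take (k - 1) \<sigma>s = take (k' - 1) \<sigma>s'"
proof -
  have "even_cf_expansion (take k cs) (take (k - 1) \<sigma>s)"
    if "even_cf p q cs \<sigma>s" "1 \<le> k" "k < length cs" for p q k cs \<sigma>s
    using that by (cases k; cases cs)
      (auto simp: even_cf_def even_cf_expansion_def dest: in_set_takeD)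
  then show ?thesis
    using assms by (intro even_cf_expansion_unique) (auto simp: cf_convergent_def)
qed

theorem theorem11:
  fixes p q r s :: int and C D :: "square list" and e :: "lifting list" and x :: lifting
  assumes D: "skew_second_cycle p q C r s D e x"
  shows "trivial_cycle r s D \<and> direction_graph (extracted_graph r s D) \<and>
    (\<forall>p' q' C' r' s' D'.
       skew_second_cycle p' q' C' r' s' D' e x \<longrightarrow>
       same_direction_graph (extracted_graph r s D) (extracted_graph r' s' D')) \<and>
    (\<forall>k cs \<sigma>s p' q' C' r' s' D' e' x' k' cs' \<sigma>s'.
       cycle_type p q C k \<and> even_cf p q cs \<sigma>s \<and>
       skew_second_cycle p' q' C' r' s' D' e' x' \<and>
       cycle_type p' q' C' k' \<and> even_cf p' q' cs' \<sigma>s' \<and>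
       cf_convergent k cs \<sigma>s = cf_convergent k' cs' \<sigma>s' \<and>
       \<sigma>s ! (k - 1) = \<sigma>s' ! (k' - 1) \<longrightarrow>
       same_direction_graph (extracted_graph r s D) (extracted_graph r' s' D'))"
proof -
  note lab = skew_second_cycle_labeled[OF D]
  obtain D1 D2 where pot: "labeled_cycle 1 0 D1 (descent_labels e x)"
    "labeled_cycle 0 1 D2 (descent_labels e x)"
    using potential_cycles[OF lab(3)] by blast
  have "trivial_cycle r s D"
    using trivial_cycle_labeled[OF lab(1,2,4,5,6) pot] .
  moreover have "direction_graph (extracted_graph r s D)"
    using direction_graph_labeled[OF lab(1,2,4,5) pot] .
  moreover have "same_direction_graph (extracted_graph r s D) (extracted_graph r' s' D')"
    if "cycle_type p q C k" "even_cf p q cs \<sigma>s" and D': "skew_second_cycle p' q' C' r' s' D' e' x'"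
      and "cycle_type p' q' C' k'" "even_cf p' q' cs' \<sigma>s'"
      and "cf_convergent k cs \<sigma>s = cf_convergent k' cs' \<sigma>s'" "\<sigma>s ! (k - 1) = \<sigma>s' ! (k' - 1)"
    for k cs \<sigma>s p' q' C' r' s' D' e' x' k' cs' \<sigma>s'
  proof -
    note T = skew_second_cycle_type[OF D that(1,2)] and T' = skew_second_cycle_type[OF D' that(4,5)]
    have "take k cs = take k' cs' \<and> take (k - 1) \<sigma>s = take (k' - 1) \<sigma>s'"
      using cf_convergent_determines[OF that(2) T(1,2) that(5) T'(1,2) that(6)] .
    then have "e' = e" "x' = x"
      using T(3,4) T'(3,4) that(7) by simp_all
    then show ?thesis
      using same_direction_graph_descent D D' by blast
  qed
  ultimately show ?thesis
    using same_direction_graph_descent[OF D] by blast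
qed

end
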